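(* Let $X$ be a locally compact Busemann space, and let $\bar X_c = X \cup \partial_c X$ and $\bar X_w = X \cup \partial_w X$ be its coarse ideal closure and its weak closure, respectively. Then there is a continuous surjective map $\mathrm{Pr} \colon \bar X_c \to \bar X_w$ such that $\mathrm{Pr}|_X = \mathrm{Id}_X$.
   Context: Write $|xy|$ for the distance in a metric space $X$. A geodesic is a locally isometric immersion of a real interval into $X$ (each parameter has a neighbourhood embedded isometrically); a complete geodesic is one defined on $\mathbb{R}$. A geodesic segment is the image of a geodesic defined on a closed interval $[a,b]$; it connects $c(a)$ and $c(b)$. A ray is an isometric embedding $c\colon [0,+\infty)\to X$. $X$ is geodesic if each point has a neighbourhood in which any two points can be connected by a geodesic segment in $X$; it is geodesically complete if moreover every geodesic segment is contained in some complete geodesic. A Busemann space is a geodesically complete metric space $X$ such that for any two geodesic segments $\gamma_1,\gamma_2\colon[0,1]\to X$ parameterized proportionally to arc length with $\gamma_1(0)=\gamma_2(0)$ one has $|\gamma_1(t)\gamma_2(t)|\le t|\gamma_1(1)\gamma_2(1)|$ for all $t\in[0,1]$. In a Busemann space any two points are connected by a unique geodesic segment, and a locally compact Busemann space is complete and proper (Hopf-Rinow). Fix $x_0\in X$. Weak closure: two rays are asymptotic if their Hausdorff distance is finite; $\partial_w X$ is the set of equivalence classes of asymptotic rays. Equivalently, it is the set of rays $c$ with $c(0)=x_0$ (each class contains exactly one such ray), and this is independent of $x_0$. For $z\in X$ let $[x_0z]$ be the geodesic segment from $x_0$ to $z$; for $z\in\partial_w X$ let $[x_0z]$ be the ray from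 $x_0$ in the class $z$, and put $|x_0z|=+\infty$. The topology on $\bar X_w=X\cup\partial_wX$ is that of uniform convergence on compacts of segments: $y_k\to y$ iff $|x_0y_k|\to|x_0y|$ in $[0,+\infty]$ and the arc length parameterizations of $[x_0y_k]$ (starting at $x_0$) converge to that of $[x_0y]$ uniformly on each compact interval $[a,b]\subset[0,|x_0y|)$ (on which they are defined for all large $k$). Coarse ideal closure: $C(X,\mathbb{R})$ is the space of continuous functions on $X$ with the topology of uniform convergence on compact sets, and $C^*(X,\mathbb{R})$ is its quotient by the constant functions. For $y\in X$ let $d_y(x)=|xy|-|x_0y|$. The map sending $y$ to the class of $d_y$ is an embedding of $X$ into $C^*(X,\mathbb{R})$, independent of $x_0$, and $X$ is identified with its image. $\bar X_c$ is the closure of this image in $C^*(X,\mathbb{R})$, with the induced topology, and $\partial_cX=\bar X_c\setminus X$.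
   Formalization: Two properties usually quoted as consequences of the definition are assumed explicitly: any two points of X are connected by a geodesic segment, and X is complete; with geodesics and geodesic completeness defined locally they do not follow, and the claim fails or is undefined without them. *)

theory Defs
  imports "HOL-Analysis.Analysis"
begin

text \<open>The metric space \<open>X\<close> is the carrier of a type of class \<^class>\<open>metric_space\<close>.\<close>

section \<open>Geodesics and Busemann spaces\<close>

definition geodesic_on :: "real set \<Rightarrow> (real \<Rightarrow> 'a::metric_space) \<Rightarrow> bool" where
  "geodesic_on I c \<longleftrightarrow> is_interval I \<and>
     (\<forall>t\<in>I. \<exists>e>0. \<forall>s\<in>I \<inter> ball t e. \<forall>u\<in>I \<inter> ball t e. dist (c s) (c u) = \<bar>s - u\<bar>)"

text \<open>Degenerate segments (\<open>a = b\<close>) are allowed, so that every point is connected to itself.\<close>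

definition geodesic_segment_between :: "'a::metric_space \<Rightarrow> 'a \<Rightarrow> 'a set \<Rightarrow> bool" where
  "geodesic_segment_between x y S \<longleftrightarrow>
     (\<exists>a b c. a \<le> b \<and> geodesic_on {a..b} c \<and> S = c ` {a..b} \<and> c a = x \<and> c b = y)"

definition geodesic_segment :: "'a::metric_space set \<Rightarrow> bool" where
  "geodesic_segment S \<longleftrightarrow> (\<exists>x y. geodesic_segment_between x y S)"

definition geodesic_space :: "'a::metric_space itself \<Rightarrow> bool" where
  "geodesic_space T \<longleftrightarrow>
     (\<forall>x::'a. \<exists>U. open U \<and> x \<in> U \<and> (\<forall>y\<in>U. \<forall>z\<in>U. \<exists>S. geodesic_segment_between y z S))"

definition geodesically_complete :: "'a::metric_space itself \<Rightarrow> bool" where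
  "geodesically_complete T \<longleftrightarrow> geodesic_space T \<and>
     (\<forall>S::'a set. geodesic_segment S \<longrightarrow> (\<exists>c. geodesic_on UNIV c \<and> S \<subseteq> range c))"

text \<open>A parameterization over \<open>[0,1]\<close> proportional to arc length is the affine
  reparameterization of a geodesic (which has unit speed) defined on some \<open>[a,b]\<close>.\<close>

definition proportional_segment :: "(real \<Rightarrow> 'a::metric_space) \<Rightarrow> bool" where
  "proportional_segment g \<longleftrightarrow>
     (\<exists>a b c. a \<le> b \<and> geodesic_on {a..b} c \<and> (\<forall>t\<in>{0..1}. g t = c (a + t * (b - a))))"

text \<open>The local definition of geodesics does not force a Busemann space to be connected, and
  geodesic completeness does not force a locally compact one to be complete: take the tree
  \<open>[0,1)\<close> with an infinite ray glued at \<open>0\<close> and at each \<open>1 - 1/2^n\<close> for \<open>n \<ge> 1\<close>. The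
  existence of segments between any two points and completeness are therefore to be assumed
  separately where needed.\<close>

definition busemann_space :: "'a::metric_space itself \<Rightarrow> bool" where
  "busemann_space T \<longleftrightarrow> geodesically_complete T \<and>
     (\<forall>g1 g2 :: real \<Rightarrow> 'a. proportional_segment g1 \<longrightarrow> proportional_segment g2 \<longrightarrow> g1 0 = g2 0 \<longrightarrow>
        (\<forall>t\<in>{0..1}. dist (g1 t) (g2 t) \<le> t * dist (g1 1) (g2 1)))"

section \<open>The weak closure\<close>

text \<open>A ray is represented by a function on all of \<open>\<real>\<close> whose values at negative arguments are
  irrelevant. Asymptoticity ignores these values as well, so the classes below are those of
  genuine rays.\<close>

definition ray :: "(real \<Rightarrow> 'a::metric_space) \<Rightarrow> bool" where
  "ray c \<longleftrightarrow> (\<forall>s\<ge>0. \<forall>t\<ge>0. dist (c s) (c t) = \<bar>s - t\<bar>)"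

definition finite_hausdorff_distance :: "'a::metric_space set \<Rightarrow> 'a set \<Rightarrow> bool" where
  "finite_hausdorff_distance A B \<longleftrightarrow>
     (\<exists>D. (\<forall>a\<in>A. \<exists>b\<in>B. dist a b \<le> D) \<and> (\<forall>b\<in>B. \<exists>a\<in>A. dist a b \<le> D))"

definition asymptotic_rel :: "((real \<Rightarrow> 'a::metric_space) \<times> (real \<Rightarrow> 'a)) set" where
  "asymptotic_rel =
     {(c, c'). ray c \<and> ray c' \<and> finite_hausdorff_distance (c ` {0..}) (c' ` {0..})}"

definition weak_boundary :: "(real \<Rightarrow> 'a::metric_space) set set" where
  "weak_boundary = {c. ray c} // asymptotic_rel"

definition weak_closure :: "('a::metric_space + (real \<Rightarrow> 'a) set) set" where
  "weak_closure = UNIV <+> weak_boundary"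

fun length_from :: "'a::metric_space \<Rightarrow> 'a + (real \<Rightarrow> 'a) set \<Rightarrow> ereal" where
  "length_from x0 (Inl z) = ereal (dist x0 z)"
| "length_from x0 (Inr \<xi>) = \<infinity>"

text \<open>The arc length parameterization of the segment, resp. ray, \<open>[x\<^sub>0z]\<close>. In the spaces under
  consideration it exists and is unique as a function on \<open>[0,|x\<^sub>0z|]\<close>, resp. \<open>[0,\<infinity>)\<close>; the choice
  only affects values outside that interval, which are never used in the limit below.\<close>

fun arc_from :: "'a::metric_space \<Rightarrow> 'a + (real \<Rightarrow> 'a) set \<Rightarrow> real \<Rightarrow> 'a" where
  "arc_from x0 (Inl z) =
     (SOME c. geodesic_on {0..dist x0 z} c \<and> c 0 = x0 \<and> c (dist x0 z) = z)"
| "arc_from x0 (Inr \<xi>) = (SOME c. c \<in> \<xi> \<and> c 0 = x0)"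

definition weak_converges ::
  "'a::metric_space \<Rightarrow> (nat \<Rightarrow> 'a + (real \<Rightarrow> 'a) set) \<Rightarrow> 'a + (real \<Rightarrow> 'a) set \<Rightarrow> bool" where
  "weak_converges x0 y z \<longleftrightarrow>
     (\<lambda>k. length_from x0 (y k)) \<longlonglongrightarrow> length_from x0 z \<and>
     (\<forall>a b. 0 \<le> a \<and> a \<le> b \<and> ereal b < length_from x0 z \<longrightarrow>
        uniform_limit {a..b} (\<lambda>k. arc_from x0 (y k)) (arc_from x0 z) sequentially)"

text \<open>The topology is prescribed through its convergent sequences, so a set is open iff it is
  sequentially open for the prescribed convergence.\<close>

definition weak_topology :: "'a::metric_space \<Rightarrow> ('a + (real \<Rightarrow> 'a) set) topology" where
  "weak_topology x0 = topology (\<lambda>U. U \<subseteq> weak_closure \<and>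
     (\<forall>z\<in>U. \<forall>y. (\<forall>k. y k \<in> weak_closure) \<and> weak_converges x0 y z \<longrightarrow>
        (\<forall>\<^sub>F k in sequentially. y k \<in> U)))"

lemma openin_weak_topology:
  "openin (weak_topology x0) U \<longleftrightarrow> U \<subseteq> weak_closure \<and>
     (\<forall>z\<in>U. \<forall>y. (\<forall>k. y k \<in> weak_closure) \<and> weak_converges x0 y z \<longrightarrow>
        (\<forall>\<^sub>F k in sequentially. y k \<in> U))"
proof -
  have "istopology (\<lambda>U. U \<subseteq> weak_closure \<and>
     (\<forall>z\<in>U. \<forall>y. (\<forall>k. y k \<in> weak_closure) \<and> weak_converges x0 y z \<longrightarrow>
        (\<forall>\<^sub>F k in sequentially. y k \<in> U)))" (is "istopology ?L")
    unfolding istopology_def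
  proof (rule conjI; intro allI impI)
    fix S T assume "?L S" "?L T"
    then show "?L (S \<inter> T)"
      by (simp add: eventually_conj_iff) blast
  next
    fix \<K> assume K: "\<forall>K\<in>\<K>. ?L K"
    have "\<forall>\<^sub>F k in sequentially. y k \<in> \<Union>\<K>"
      if z: "z \<in> \<Union>\<K>" and y: "\<forall>k. y k \<in> weak_closure" "weak_converges x0 y z" for z y
    proof -
      obtain A where A: "A \<in> \<K>" "z \<in> A" using z by blast
      with K y have "\<forall>\<^sub>F k in sequentially. y k \<in> A" by blast
      then show ?thesis by (rule eventually_mono) (use A in blast)
    qed
    moreover have "\<Union>\<K> \<subseteq> weak_closure" using K by blast
    ultimately show "?L (\<Union>\<K>)" by simp
  qed
  from topology_inverse'[OF this] show ?thesis
    unfolding weak_topology_def by (rule fun_cong)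
qed

lemma topspace_weak_topology: "topspace (weak_topology x0) = weak_closure"
proof (rule antisym)
  show "topspace (weak_topology x0) \<subseteq> weak_closure"
    by (auto simp: topspace_def openin_weak_topology)
  have "openin (weak_topology x0) weak_closure"
    by (simp add: openin_weak_topology)
  then show "weak_closure \<subseteq> topspace (weak_topology x0)"
    by (rule openin_subset)
qed

section \<open>The coarse ideal closure\<close>

text \<open>\<open>C(X,\<real>)\<close> with the topology of uniform convergence on compact sets.\<close>

definition cont_fun_topology :: "('a::metric_space \<Rightarrow> real) topology" where
  "cont_fun_topology = topology (\<lambda>U. U \<subseteq> {f. continuous_on UNIV f} \<and>
     (\<forall>f\<in>U. \<exists>K e. compact K \<and> 0 < e \<and>
        {g. continuous_on UNIV g \<and> (\<forall>x\<in>K. \<bar>g x - f x\<bar> < e)} \<subseteq> U))"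

lemma openin_cont_fun_topology:
  "openin cont_fun_topology (U :: ('a::metric_space \<Rightarrow> real) set) \<longleftrightarrow>
     U \<subseteq> {f. continuous_on UNIV f} \<and>
     (\<forall>f\<in>U. \<exists>K e. compact K \<and> 0 < e \<and>
        {g. continuous_on UNIV g \<and> (\<forall>x\<in>K. \<bar>g x - f x\<bar> < e)} \<subseteq> U)"
proof -
  have "istopology (\<lambda>U :: ('a \<Rightarrow> real) set. U \<subseteq> {f. continuous_on UNIV f} \<and>
     (\<forall>f\<in>U. \<exists>K e. compact K \<and> 0 < e \<and>
        {g. continuous_on UNIV g \<and> (\<forall>x\<in>K. \<bar>g x - f x\<bar> < e)} \<subseteq> U))" (is "istopology ?L")
    unfolding istopology_def
  proof (rule conjI; intro allI impI)
    fix S T assume S: "?L S" and T: "?L T"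
    have "\<exists>K e. compact K \<and> 0 < e \<and>
        {g. continuous_on UNIV g \<and> (\<forall>x\<in>K. \<bar>g x - f x\<bar> < e)} \<subseteq> S \<inter> T"
      if f: "f \<in> S \<inter> T" for f
    proof -
      from S f obtain K d where K: "compact K" "0 < d"
        "{g. continuous_on UNIV g \<and> (\<forall>x\<in>K. \<bar>g x - f x\<bar> < d)} \<subseteq> S" by blast
      from T f obtain L e where L: "compact L" "0 < e"
        "{g. continuous_on UNIV g \<and> (\<forall>x\<in>L. \<bar>g x - f x\<bar> < e)} \<subseteq> T" by blast
      show ?thesis
      proof (intro exI[of _ "K \<union> L"] exI[of _ "min d e"] conjI)
        show "compact (K \<union> L)" "0 < min d e" using K L by auto
        show "{g. continuous_on UNIV g \<and> (\<forall>x\<in>K \<union> L. \<bar>g x - f x\<bar> < min d e)} \<subseteq> S \<inter> T"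
          using K(3) L(3) by auto
      qed
    qed
    moreover have "S \<inter> T \<subseteq> {f. continuous_on UNIV f}" using S by blast
    ultimately show "?L (S \<inter> T)" by simp
  next
    fix \<K> assume K: "\<forall>K\<in>\<K>. ?L K"
    have "\<exists>K e. compact K \<and> 0 < e \<and>
        {g. continuous_on UNIV g \<and> (\<forall>x\<in>K. \<bar>g x - f x\<bar> < e)} \<subseteq> \<Union>\<K>"
      if f: "f \<in> \<Union>\<K>" for f
    proof -
      obtain A where A: "A \<in> \<K>" "f \<in> A" using f by blast
      then obtain L e where L: "compact L" "0 < e"
        "{g. continuous_on UNIV g \<and> (\<forall>x\<in>L. \<bar>g x - f x\<bar> < e)} \<subseteq> A"
        using bspec[OF conjunct2[OF bspec[OF K A(1)]] A(2)] by (elim exE conjE)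
      from L(3) A(1) have "{g. continuous_on UNIV g \<and> (\<forall>x\<in>L. \<bar>g x - f x\<bar> < e)} \<subseteq> \<Union>\<K>"
        by (rule order_trans[OF _ Union_upper])
      with L(1,2) show ?thesis by (intro exI conjI)
    qed
    moreover have "\<Union>\<K> \<subseteq> {f. continuous_on UNIV f}" using K by blast
    ultimately show "?L (\<Union>\<K>)" by simp
  qed
  from topology_inverse'[OF this] show ?thesis
    unfolding cont_fun_topology_def by (rule fun_cong)
qed

lemma topspace_cont_fun_topology: "topspace cont_fun_topology = {f. continuous_on UNIV f}"
proof (rule antisym)
  show "topspace cont_fun_topology \<subseteq> {f. continuous_on UNIV f}"
    by (auto simp: topspace_def openin_cont_fun_topology)
  have "openin cont_fun_topology {f::'a::metric_space \<Rightarrow> real. continuous_on UNIV f}"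
    unfolding openin_cont_fun_topology
    by (intro conjI ballI exI[of _ "{}"] exI[of _ "1::real"]) auto
  then show "{f::'a \<Rightarrow> real. continuous_on UNIV f} \<subseteq> topspace cont_fun_topology"
    by (rule openin_subset)
qed

definition quotient_topology :: "'a topology \<Rightarrow> ('a \<Rightarrow> 'b) \<Rightarrow> 'b topology" where
  "quotient_topology X q =
     topology (\<lambda>V. V \<subseteq> q ` topspace X \<and> openin X {x \<in> topspace X. q x \<in> V})"

lemma openin_quotient_topology:
  "openin (quotient_topology X q) V \<longleftrightarrow>
     V \<subseteq> q ` topspace X \<and> openin X {x \<in> topspace X. q x \<in> V}"
proof -
  have "istopology (\<lambda>V. V \<subseteq> q ` topspace X \<and> openin X {x \<in> topspace X. q x \<in> V})"
    (is "istopology ?L")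
    unfolding istopology_def
  proof (intro conjI allI impI)
    fix S T assume "?L S" "?L T"
    moreover have "{x \<in> topspace X. q x \<in> S \<inter> T} =
        {x \<in> topspace X. q x \<in> S} \<inter> {x \<in> topspace X. q x \<in> T}" by blast
    ultimately show "S \<inter> T \<subseteq> q ` topspace X" "openin X {x \<in> topspace X. q x \<in> S \<inter> T}"
      by auto
  next
    fix \<K> assume K: "\<forall>K\<in>\<K>. ?L K"
    then show "\<Union>\<K> \<subseteq> q ` topspace X" by blast
    have "{x \<in> topspace X. q x \<in> \<Union>\<K>} = (\<Union>K\<in>\<K>. {x \<in> topspace X. q x \<in> K})" by blast
    moreover have "openin X (\<Union>K\<in>\<K>. {x \<in> topspace X. q x \<in> K})"
      by (rule openin_Union) (use K in blast)
    ultimately show "openin X {x \<in> topspace X. q x \<in> \<Union>\<K>}" by simp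
  qed
  from topology_inverse'[OF this] show ?thesis
    unfolding quotient_topology_def by (rule fun_cong)
qed

lemma quotient_map_quotient_topology: "quotient_map X (quotient_topology X q) q"
proof -
  have "{x \<in> topspace X. q x \<in> q ` topspace X} = topspace X" by blast
  then have "openin (quotient_topology X q) (q ` topspace X)"
    by (simp add: openin_quotient_topology)
  then have "topspace (quotient_topology X q) = q ` topspace X"
    by (metis openin_quotient_topology[of X q "topspace (quotient_topology X q)"]
        openin_subset openin_topspace subset_antisym)
  then show ?thesis
    by (simp add: quotient_map_def openin_quotient_topology)
qed

definition const_class :: "('a \<Rightarrow> real) \<Rightarrow> ('a \<Rightarrow> real) set" where
  "const_class f = {\<lambda>x. f x + a | a. True}"

definition cont_fun_mod_const_topology :: "('a::metric_space \<Rightarrow> real) set topology" where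
  "cont_fun_mod_const_topology = quotient_topology cont_fun_topology const_class"

definition coarse_embedding :: "'a::metric_space \<Rightarrow> 'a \<Rightarrow> ('a \<Rightarrow> real) set" where
  "coarse_embedding x0 y = const_class (\<lambda>x. dist x y - dist x0 y)"

definition coarse_closure :: "'a::metric_space \<Rightarrow> ('a \<Rightarrow> real) set set" where
  "coarse_closure x0 = cont_fun_mod_const_topology closure_of range (coarse_embedding x0)"

definition coarse_topology :: "'a::metric_space \<Rightarrow> ('a \<Rightarrow> real) set topology" where
  "coarse_topology x0 = subtopology cont_fun_mod_const_topology (coarse_closure x0)"

end

theory Submission
  imports Defs
begin

text \<open>
  Points of the coarse closure are classes of limits \<open>f\<close>, uniform on compact sets, of the functions
  \<open>|xy| - |x0 y|\<close>; normalize \<open>f\<close> by \<open>f x0 = 0\<close>.  The projection follows the steepest descent of \<open>f\<close>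
  from \<open>x0\<close>.  Such an \<open>f\<close> is 1-Lipschitz and convex along segments, so on the closed ball of radius \<open>t\<close>
  around \<open>x0\<close> it is at least \<open>- t\<close>, and the points where it equals \<open>- t\<close>, the gradient points, are
  unique because balls in a Busemann space are strictly convex (\<open>balls_strictly_convex\<close>,
  \<open>gradient_point_unique\<close>).  They exist exactly for the levels \<open>t\<close> up to the supremum of \<open>- f\<close>, thanks to
  the compactness of balls (\<open>compact_cball\<close>, \<open>gradient_point_exists\<close>), and they form a geodesic from
  \<open>x0\<close>.  If the supremum is finite, \<open>f\<close> is the distance function of the end of that geodesic
  (\<open>distance_limit_bounded_below\<close>); if not, the geodesic is a ray.  This is the projection, and on the
  image of \<open>X\<close> it is the identity.

  Continuity: on a compact ball a function that is close to \<open>f\<close> has its near minimizers close to those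
  of \<open>f\<close> (\<open>gradient_point_stable\<close>), so gradient points depend continuously on \<open>f\<close>, and
  the Busemann inequality makes the convergence uniform along arcs
  (\<open>steepest_descent_converges\<close>).  The coarse closure is first countable, so sequences suffice.

  Surjectivity: the Busemann function of a ray \<open>c\<close> from \<open>x0\<close> is a limit of the distance functions of the
  points \<open>c(n)\<close> and has the value \<open>- t\<close> at \<open>c(t)\<close> (\<open>ray_busemann_function\<close>).  The same construction, for a
  ray that starts elsewhere, shows that every asymptoticity class contains a ray from \<open>x0\<close>
  (\<open>asymptotic_ray_from\<close>); only one, since distances between rays with a common origin grow at least
  linearly unless the rays agree (\<open>asymptotic_rays_eq\<close>).

  Underneath lies the fact that local geodesics are isometric embeddings, obtained by comparing a
  geodesic with a constant segment (\<open>geodesic_on_dist_ge\<close>).  From then on segments are handled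
  through the two distances that determine their points.\<close>

section \<open>Local geodesics and segments\<close>

text \<open>The point dividing \<open>[xy]\<close> in the ratio \<open>t : 1 - t\<close>, described by its two distances alone.  In a
  Busemann space these distances determine the point, so all later arguments about geodesics
  become computations with distances.\<close>

definition seg :: "'a::metric_space \<Rightarrow> 'a \<Rightarrow> real \<Rightarrow> 'a" where
  "seg x y t = (THE p. dist x p = t * dist x y \<and> dist p y = (1 - t) * dist x y)"

lemma isometric_imp_geodesic_on:
  assumes "is_interval I" "\<And>s u. s \<in> I \<Longrightarrow> u \<in> I \<Longrightarrow> dist (c s) (c u) = \<bar>s - u\<bar>"
  shows "geodesic_on I c"
  using assms unfolding geodesic_on_def by (auto intro!: exI[of _ 1])

lemma geodesic_on_subset:
  assumes "geodesic_on I c" "J \<subseteq> I" "is_interval J"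
  shows "geodesic_on J c"
  unfolding geodesic_on_def
proof (intro conjI ballI)
  fix t assume "t \<in> J"
  then obtain e where "e > 0" "\<forall>s\<in>I \<inter> ball t e. \<forall>u\<in>I \<inter> ball t e. dist (c s) (c u) = \<bar>s - u\<bar>"
    using assms unfolding geodesic_on_def by blast
  then show "\<exists>e>0. \<forall>s\<in>J \<inter> ball t e. \<forall>u\<in>J \<inter> ball t e. dist (c s) (c u) = \<bar>s - u\<bar>"
    using assms(2) by blast
qed (fact assms(3))

text \<open>A local isometry of an interval is 1-Lipschitz: the inequality holds on short intervals
  around every parameter and is additive under concatenation, so Bolzano's bisection principle
  yields it on all of \<open>[a,b]\<close>.\<close>

lemma geodesic_on_dist_le:
  assumes c: "geodesic_on {a..b} c" and ab: "a \<le> b"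
  shows "dist (c a) (c b) \<le> b - a"
proof -
  have "a \<le> a \<longrightarrow> b \<le> b \<longrightarrow> dist (c a) (c b) \<le> b - a"
    using ab
  proof (rule Bolzano[where P = "\<lambda>s u. a \<le> s \<longrightarrow> u \<le> b \<longrightarrow> dist (c s) (c u) \<le> u - s"])
    fix p q r assume "a \<le> p \<longrightarrow> q \<le> b \<longrightarrow> dist (c p) (c q) \<le> q - p"
      "a \<le> q \<longrightarrow> r \<le> b \<longrightarrow> dist (c q) (c r) \<le> r - q" "p \<le> q" "q \<le> r"
    then show "a \<le> p \<longrightarrow> r \<le> b \<longrightarrow> dist (c p) (c r) \<le> r - p"
      using dist_triangle[of "c p" "c r" "c q"] by auto
  next
    fix x assume "a \<le> x" "x \<le> b"
    then obtain e where e: "e > 0"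
      "\<forall>s\<in>{a..b} \<inter> ball x e. \<forall>u\<in>{a..b} \<inter> ball x e. dist (c s) (c u) = \<bar>s - u\<bar>"
      using c unfolding geodesic_on_def by (meson atLeastAtMost_iff)
    show "\<exists>d>0. \<forall>s u. s \<le> x \<and> x \<le> u \<and> u - s < d \<longrightarrow>
        a \<le> s \<longrightarrow> u \<le> b \<longrightarrow> dist (c s) (c u) \<le> u - s"
    proof (intro exI[of _ e] conjI allI impI)
      fix s u assume "s \<le> x \<and> x \<le> u \<and> u - s < e" "a \<le> s" "u \<le> b"
      then have "s \<in> {a..b} \<inter> ball x e" "u \<in> {a..b} \<inter> ball x e" by (auto simp: dist_real_def)
      with e(2) have "dist (c s) (c u) = \<bar>s - u\<bar>" by blast
      then show "dist (c s) (c u) \<le> u - s"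
        using \<open>s \<le> x \<and> x \<le> u \<and> u - s < e\<close> by simp
    qed (fact e(1))
  qed
  then show ?thesis by simp
qed

locale connected_busemann =
  fixes T :: "'a::metric_space itself"
  assumes busemann: "busemann_space T"
    and connected: "\<forall>x y :: 'a. \<exists>S. geodesic_segment_between x y S"
begin

lemma busemann_ineq:
  fixes g1 g2 :: "real \<Rightarrow> 'a"
  assumes "proportional_segment g1" "proportional_segment g2" "g1 0 = g2 0" "0 \<le> t" "t \<le> 1"
  shows "dist (g1 t) (g2 t) \<le> t * dist (g1 1) (g2 1)"
  using busemann assms unfolding busemann_space_def by simp

text \<open>The Busemann inequality, applied to the local geodesic and to the constant segment at its
  initial point, says that the relative distance from the initial point is nondecreasing in
  the parameter.  Near the initial point the geodesic is isometric, so its speed is 1 there, and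
  hence the endpoint is at distance at least \<open>b - a\<close>.\<close>

lemma geodesic_on_dist_ge:
  fixes c :: "real \<Rightarrow> 'a"
  assumes c: "geodesic_on {a..b} c" and ab: "a \<le> b"
  shows "b - a \<le> dist (c a) (c b)"
proof (cases "a = b")
  case False
  with ab have "a < b" by simp
  define g where "g t = c (a + t * (b - a))" for t
  have g: "proportional_segment g"
    using c ab unfolding proportional_segment_def g_def by blast
  have k: "proportional_segment (\<lambda>_. c a)"
    unfolding proportional_segment_def
    by (intro exI[of _ 0] exI[of _ 0] exI[of _ "\<lambda>_. c a"])
      (auto intro!: isometric_imp_geodesic_on simp: is_interval_convex_1)
  obtain e where e: "e > 0"
    "\<forall>s\<in>{a..b} \<inter> ball a e. \<forall>u\<in>{a..b} \<inter> ball a e. dist (c s) (c u) = \<bar>s - u\<bar>"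
    using c ab unfolding geodesic_on_def by (meson atLeastAtMost_iff order_refl)
  \<comment> \<open>a proportion small enough for the corresponding parameter to lie in the isometric range\<close>
  define t where "t = min 1 (e / (2 * (b - a)))"
  have t: "0 < t" "t \<le> 1" using e(1) \<open>a < b\<close> unfolding t_def by auto
  have "t * (b - a) \<le> e / (2 * (b - a)) * (b - a)"
    using \<open>a < b\<close> by (intro mult_right_mono) (auto simp: t_def)
  also have "\<dots> = e / 2" using \<open>a < b\<close> by (auto simp: divide_simps)
  finally have te: "t * (b - a) < e" using e(1) by simp
  have "t * (b - a) \<le> b - a" using mult_right_mono[of t 1 "b - a"] t \<open>a < b\<close> by simp
  moreover have "0 < t * (b - a)" using t \<open>a < b\<close> by simp
  moreover define u where "u = a + t * (b - a)"
  ultimately have "a < u" "u \<le> b" "u - a < e" using te by auto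
  then have "u \<in> {a..b} \<inter> ball a e" "a \<in> {a..b} \<inter> ball a e"
    using e(1) by (auto simp: dist_real_def)
  with e(2) have "dist (c u) (c a) = \<bar>u - a\<bar>" by blast
  then have "dist (g t) (c a) = t * (b - a)"
    using \<open>a < u\<close> by (simp add: g_def u_def)
  moreover have "dist (g t) (c a) \<le> t * dist (g 1) (c a)"
    using busemann_ineq[OF g k] t by (simp add: g_def)
  ultimately have "b - a \<le> dist (g 1) (c a)" using t by simp
  then show ?thesis by (simp add: g_def dist_commute)
qed simp

lemma geodesic_on_isometric:
  fixes c :: "real \<Rightarrow> 'a"
  assumes c: "geodesic_on {a..b} c" and s: "s \<in> {a..b}" and u: "u \<in> {a..b}"
  shows "dist (c s) (c u) = \<bar>s - u\<bar>"
proof -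
  have *: "dist (c s) (c u) = u - s" if "a \<le> s" "s \<le> u" "u \<le> b" for s u
  proof -
    have "geodesic_on {s..u} c"
      using that by (intro geodesic_on_subset[OF c]) (auto simp: is_interval_cc)
    then show ?thesis
      using geodesic_on_dist_le geodesic_on_dist_ge that by (intro antisym) blast+
  qed
  show ?thesis
  proof (cases "s \<le> u")
    case True with * s u show ?thesis by auto
  next
    case False with *[of u s] s u show ?thesis by (auto simp: dist_commute)
  qed
qed

lemma ex_isometric_segment:
  obtains c where "c 0 = x" "c (dist x y) = (y :: 'a)"
    "\<And>s u. 0 \<le> s \<Longrightarrow> s \<le> dist x y \<Longrightarrow> 0 \<le> u \<Longrightarrow> u \<le> dist x y \<Longrightarrow> dist (c s) (c u) = \<bar>s - u\<bar>"
proof -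
  obtain a b c where c: "a \<le> b" "geodesic_on {a..b} c" "c a = x" "c b = y"
    using connected unfolding geodesic_segment_between_def by metis
  have iso: "dist (c s) (c u) = \<bar>s - u\<bar>" if "s \<in> {a..b}" "u \<in> {a..b}" for s u
    using geodesic_on_isometric[OF c(2)] that by blast
  have d: "dist x y = b - a" using iso[of a b] c by simp
  show thesis
  proof (rule that[of "\<lambda>s. c (a + s)"])
    show "dist (c (a + s)) (c (a + u)) = \<bar>s - u\<bar>"
      if "0 \<le> s" "s \<le> dist x y" "0 \<le> u" "u \<le> dist x y" for s u
      using that iso[of "a + s" "a + u"] d by simp
  qed (use c d in auto)
qed

lemma proportional_segment_isometric:
  assumes "0 \<le> d" and "\<And>s u. 0 \<le> s \<Longrightarrow> s \<le> d \<Longrightarrow> 0 \<le> u \<Longrightarrow> u \<le> d \<Longrightarrow> dist (c s) (c u) = \<bar>s - u\<bar>"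
  shows "proportional_segment (\<lambda>t. c (t * d))"
  unfolding proportional_segment_def
  by (intro exI[of _ 0] exI[of _ d] exI[of _ c])
    (use assms in \<open>auto intro!: isometric_imp_geodesic_on simp: is_interval_cc\<close>)

text \<open>A point \<open>p\<close> with \<open>|xp| + |py| = |xy|\<close> lies on a segment from \<open>x\<close> to \<open>y\<close>: for the concatenation of
  \<open>[xp]\<close> and \<open>[py]\<close> the triangle inequality is an equality between the endpoints, which forces
  equality between any two intermediate points.  Together with the uniqueness of segments this
  makes metric betweenness determine points.\<close>

lemma proportional_segment_through:
  fixes x y p :: 'a
  assumes t: "0 \<le> t" "t \<le> 1"
    and p: "dist x p = t * dist x y" "dist p y = (1 - t) * dist x y"
  shows "\<exists>g. proportional_segment g \<and> g 0 = x \<and> g 1 = y \<and> g t = p"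
proof (cases "x = y")
  case True
  with p have "p = x" by simp
  have "proportional_segment (\<lambda>_. x)"
    using proportional_segment_isometric[of 0 "\<lambda>_. x"] by auto
  with True \<open>p = x\<close> show ?thesis by auto
next
  case False
  define d where "d = dist x y"
  have d: "0 < d" using False by (simp add: d_def)
  obtain c1 where c1: "c1 0 = x" "c1 (dist x p) = p"
    "\<And>s u. 0 \<le> s \<Longrightarrow> s \<le> dist x p \<Longrightarrow> 0 \<le> u \<Longrightarrow> u \<le> dist x p \<Longrightarrow> dist (c1 s) (c1 u) = \<bar>s - u\<bar>"
    using ex_isometric_segment by blast
  obtain c2 where c2: "c2 0 = p" "c2 (dist p y) = y"
    "\<And>s u. 0 \<le> s \<Longrightarrow> s \<le> dist p y \<Longrightarrow> 0 \<le> u \<Longrightarrow> u \<le> dist p y \<Longrightarrow> dist (c2 s) (c2 u) = \<bar>s - u\<bar>"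
    using ex_isometric_segment by blast
  define r where "r = dist x p"
  have r: "r + dist p y = d" "0 \<le> r" "r = t * d"
    using p zero_le_dist[of x p] unfolding r_def d_def by (simp_all add: algebra_simps)
  define c where "c s = (if s \<le> r then c1 s else c2 (s - r))" for s
  have iso_le: "dist (c s) (c u) = u - s" if "0 \<le> s" "s \<le> u" "u \<le> d" for s u
  proof -
    consider "u \<le> r" | "s \<le> r" "r < u" | "r < s" by linarith
    then show ?thesis
    proof cases
      case 1
      then show ?thesis using that c1(3)[of s u] by (simp add: c_def r_def)
    next
      case 3
      then show ?thesis using that c2(3)[of "s - r" "u - r"] r by (simp add: c_def)
    next
      case 2
      have e: "c s = c1 s" "c u = c2 (u - r)" using 2 by (auto simp: c_def)
      have "dist (c1 s) p = r - s" "dist x (c1 s) = s"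
        using that 2 c1(3)[of s r] c1(3)[of 0 s] c1(1,2) r by (auto simp: r_def)
      moreover have "dist p (c2 (u - r)) = u - r" "dist (c2 (u - r)) y = d - u"
        using that 2 c2(3)[of 0 "u - r"] c2(3)[of "u - r" "dist p y"] c2(1,2) r by auto
      moreover have "d \<le> dist x (c1 s) + dist (c1 s) (c2 (u - r)) + dist (c2 (u - r)) y"
        using dist_triangle[of x y "c1 s"] dist_triangle[of "c1 s" y "c2 (u - r)"]
        unfolding d_def by linarith
      moreover have "dist (c1 s) (c2 (u - r)) \<le> dist (c1 s) p + dist p (c2 (u - r))"
        by (rule dist_triangle)
      ultimately show ?thesis using e by simp
    qed
  qed
  have iso: "dist (c s) (c u) = \<bar>s - u\<bar>" if "0 \<le> s" "s \<le> d" "0 \<le> u" "u \<le> d" for s u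
    using iso_le[of s u] iso_le[of u s] that by (cases "s \<le> u") (auto simp: dist_commute)
  have "proportional_segment (\<lambda>t. c (t * d))"
    by (rule proportional_segment_isometric) (use d iso in auto)
  moreover have "c 0 = x" using r c1 by (simp add: c_def)
  moreover have "c d = y"
  proof (cases "d \<le> r")
    case True
    with r(1) have "dist p y \<le> 0" by linarith
    then have "p = y" by simp
    moreover from this r(1) have "d = r" by simp
    ultimately show ?thesis using c1 by (simp add: c_def r_def)
  next
    case False
    have "d - r = dist p y" using r by simp
    with False c2 show ?thesis by (simp add: c_def)
  qed
  moreover have "c (t * d) = p" using c1 r by (simp add: c_def r_def)
  ultimately show ?thesis by (intro exI[of _ "\<lambda>t. c (t * d)"]) simp
qed

text \<open>Two segments with common endpoints coincide, because the Busemann inequality bounds the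
  distance between corresponding points by a multiple of the distance 0 between the far ends.\<close>

lemma between_unique:
  fixes x y p q :: 'a
  assumes "0 \<le> t" "t \<le> 1"
    and "dist x p = t * dist x y" "dist p y = (1 - t) * dist x y"
    and "dist x q = t * dist x y" "dist q y = (1 - t) * dist x y"
  shows "p = q"
proof -
  obtain g h where g: "proportional_segment g" "g 0 = x" "g 1 = y" "g t = p"
    and h: "proportional_segment h" "h 0 = x" "h 1 = y" "h t = q"
    using proportional_segment_through assms by metis
  have "dist (g t) (h t) \<le> t * dist (g 1) (h 1)"
    by (rule busemann_ineq) (use g h assms in auto)
  with g h show ?thesis by simp
qed

lemma seg_exists:
  fixes x y :: 'a
  assumes "0 \<le> t" "t \<le> 1"
  shows "\<exists>p. dist x p = t * dist x y \<and> dist p y = (1 - t) * dist x y"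
proof -
  obtain c where c: "c 0 = x" "c (dist x y) = y"
    "\<And>s u. 0 \<le> s \<Longrightarrow> s \<le> dist x y \<Longrightarrow> 0 \<le> u \<Longrightarrow> u \<le> dist x y \<Longrightarrow> dist (c s) (c u) = \<bar>s - u\<bar>"
    using ex_isometric_segment by blast
  have t: "0 \<le> t * dist x y" "t * dist x y \<le> dist x y"
    using assms by (auto intro: mult_left_le_one_le)
  have "dist x (c (t * dist x y)) = t * dist x y"
    using c(3)[of 0 "t * dist x y"] c(1) t by simp
  moreover have "dist (c (t * dist x y)) y = dist x y - t * dist x y"
    using c(3)[of "t * dist x y" "dist x y"] c(2) t by simp
  ultimately show ?thesis by (auto simp: algebra_simps)
qed

lemma seg_eqI:
  fixes x y p :: 'a
  assumes "0 \<le> t" "t \<le> 1" "dist x p = t * dist x y" "dist p y = (1 - t) * dist x y"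
  shows "seg x y t = p"
  unfolding seg_def using assms between_unique by blast

lemma
  fixes x y :: 'a
  assumes "0 \<le> t" "t \<le> 1"
  shows dist_seg_left: "dist x (seg x y t) = t * dist x y"
    and dist_seg_right: "dist (seg x y t) y = (1 - t) * dist x y"
  using seg_exists[OF assms, of x y] seg_eqI[OF assms] by auto

lemma seg_commute:
  fixes x y :: 'a
  assumes "0 \<le> t" "t \<le> 1"
  shows "seg x y t = seg y x (1 - t)"
  by (rule seg_eqI)
    (use assms dist_seg_left[of "1 - t" y x] dist_seg_right[of "1 - t" y x]
      in \<open>simp_all add: dist_commute\<close>)

lemma seg_convex:
  fixes x y z :: 'a
  assumes t: "0 \<le> t" "t \<le> 1"
  shows "dist (seg x y t) (seg x z t) \<le> t * dist y z"
proof -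
  obtain g h where g: "proportional_segment g" "g 0 = x" "g 1 = y" "g t = seg x y t"
    and h: "proportional_segment h" "h 0 = x" "h 1 = z" "h t = seg x z t"
    using proportional_segment_through[OF t dist_seg_left[OF t] dist_seg_right[OF t]] by metis
  have "dist (g t) (h t) \<le> t * dist (g 1) (h 1)"
    by (rule busemann_ineq) (use g h t in auto)
  with g h show ?thesis by simp
qed

text \<open>The comparison point on the segment from \<open>p\<close> to \<open>y\<close> splits the estimate into a
  Busemann inequality in the triangle \<open>p q y\<close> and a distance measured along \<open>[py]\<close>.\<close>

lemma dist_convex:
  fixes p q y :: 'a
  assumes t: "0 \<le> t" "t \<le> 1"
  shows "dist (seg p q t) y \<le> (1 - t) * dist p y + t * dist q y"
  using dist_triangle[of "seg p q t" y "seg p y t"] seg_convex[OF t, of p q y]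
    dist_seg_right[OF t, of p y] by linarith

text \<open>Suppose that the midpoint \<open>m\<close> of \<open>[pq]\<close> were as far from \<open>x\<close> as \<open>p\<close> and \<open>q\<close> are.  The midpoint of
  \<open>[xp]\<close> is within \<open>r/2\<close> of \<open>m\<close> by the Busemann inequality at \<open>p\<close>, hence it is a midpoint of
  \<open>[xm]\<close>, and so is the midpoint of \<open>[xq]\<close>.  Thus the three segments from \<open>x\<close> share a first half,
  and the situation repeats at half the scale, seen from the common midpoint.  Iterating,
  \<open>p\<close> and \<open>q\<close> are within \<open>r/2^n\<close> of a common point for every \<open>n\<close>.  (Segments in a Busemann space
  may branch, so a shared first half alone is no contradiction.)\<close>

lemma balls_strictly_convex:
  fixes x p q :: 'a
  assumes p: "dist x p \<le> r" and q: "dist x q \<le> r" and m: "r \<le> dist x (seg p q (1/2))"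
  shows "p = q"
proof -
  let ?m = "seg p q (1/2)"
  have halve: "\<exists>x'. dist x' p \<le> r / 2 \<and> dist x' q \<le> r / 2 \<and> r / 2 \<le> dist x' ?m"
    if p: "dist x p \<le> r" and q: "dist x q \<le> r" and m: "r \<le> dist x ?m" for x r
  proof -
    have "dist ?m x \<le> (1 - 1/2) * dist p x + 1/2 * dist q x" by (rule dist_convex) auto
    with p q m have e: "dist x p = r" "dist x q = r" "dist x ?m = r"
      by (auto simp: dist_commute)
    have mid: "seg x w (1/2) = seg x ?m (1/2)"
      if w: "dist x w = r" and v: "dist x v = r" and wv: "?m = seg w v (1/2)" for w v
    proof -
      have "dist (seg w x (1/2)) ?m \<le> 1/2 * dist x v"
        unfolding wv by (rule seg_convex) auto
      moreover have "seg x w (1/2) = seg w x (1/2)" using seg_commute[of "1/2" x w] by simp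
      ultimately have 1: "dist (seg x w (1/2)) ?m \<le> r / 2" using v by simp
      have 2: "dist x (seg x w (1/2)) = r / 2" using w by (simp add: dist_seg_left)
      have "dist (seg x w (1/2)) ?m = r / 2"
        using 1 2 e(3) dist_triangle[of x ?m "seg x w (1/2)"] by linarith
      with 2 show ?thesis by (intro seg_eqI[symmetric]) (use e(3) in auto)
    qed
    have pm: "seg x p (1/2) = seg x ?m (1/2)" by (rule mid[OF e(1,2)]) simp
    have qm: "seg x q (1/2) = seg x ?m (1/2)"
      by (rule mid[OF e(2,1)]) (use seg_commute[of "1/2" p q] in simp)
    have "dist (seg x ?m (1/2)) p = r / 2"
      unfolding pm[symmetric] using e(1) by (simp add: dist_seg_right)
    moreover have "dist (seg x ?m (1/2)) q = r / 2"
      unfolding qm[symmetric] using e(2) by (simp add: dist_seg_right)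
    moreover have "dist (seg x ?m (1/2)) ?m = r / 2"
      using e(3) by (simp add: dist_seg_right)
    ultimately show ?thesis by (intro exI[of _ "seg x ?m (1/2)"]) simp
  qed
  have iter: "\<exists>x'. dist x' p \<le> r / 2 ^ n \<and> dist x' q \<le> r / 2 ^ n \<and> r / 2 ^ n \<le> dist x' ?m" for n
  proof (induction n)
    case 0 then show ?case using p q m by auto
  next
    case (Suc n) then show ?case using halve[of _ "r / 2 ^ n"] by (auto simp: mult.commute)
  qed
  have "dist p q \<le> 2 * (r / 2 ^ n)" for n
  proof -
    obtain x' where "dist x' p \<le> r / 2 ^ n" "dist x' q \<le> r / 2 ^ n" using iter by blast
    then show ?thesis using dist_triangle3[of p q x'] by linarith
  qed
  moreover have "(\<lambda>n. 2 * (r / 2 ^ n)) \<longlonglongrightarrow> 0"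
    using tendsto_mult_right_zero[OF LIMSEQ_divide_realpow_zero[of 2 r], of 2] by simp
  ultimately have "dist p q \<le> 0" by (intro LIMSEQ_le_const) auto
  then show ?thesis by simp
qed

text \<open>Transfers the estimates for \<^const>\<open>seg\<close> to rays and to arcs parameterized by length.\<close>

lemma isometric_eq_seg:
  fixes c :: "real \<Rightarrow> 'a"
  assumes iso: "\<And>s u. 0 \<le> s \<Longrightarrow> s \<le> L \<Longrightarrow> 0 \<le> u \<Longrightarrow> u \<le> L \<Longrightarrow> dist (c s) (c u) = \<bar>s - u\<bar>"
    and "0 \<le> s" "s \<le> u" "u \<le> L" "0 < u"
  shows "c s = seg (c 0) (c u) (s / u)"
proof (rule seg_eqI[symmetric])
  have d: "dist (c 0) (c s) = s" "dist (c s) (c u) = u - s" "dist (c 0) (c u) = u"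
    using assms(2-) iso[of 0 s] iso[of s u] iso[of 0 u] by auto
  show "dist (c 0) (c s) = s / u * dist (c 0) (c u)"
    "dist (c s) (c u) = (1 - s / u) * dist (c 0) (c u)"
    unfolding d using assms(5) by (simp_all add: left_diff_distrib)
qed (use assms(2-) in auto)

end

section \<open>Compactness of closed balls\<close>

locale proper_busemann = connected_busemann T for T :: "'a::metric_space itself" +
  assumes loc_compact: "locally compact (UNIV :: 'a set)"
    and complete: "complete (UNIV :: 'a set)"
begin

text \<open>Local compactness gives every point a ball inside a compact set; finitely many of the
  half-sized balls cover \<open>K\<close>, and the smallest radius provides a uniform enlargement.\<close>

lemma compact_enlarge:
  fixes K :: "'a set"
  assumes K: "compact K"
  shows "\<exists>e>0. \<exists>C. compact C \<and> (\<forall>x\<in>K. cball x e \<subseteq> C)"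
proof -
  have "\<exists>e>0. \<exists>C. compact C \<and> ball x e \<subseteq> C" for x :: 'a
  proof -
    obtain U V where UV: "open U" "compact V" "x \<in> U" "U \<subseteq> V"
      using loc_compact[unfolded locally_def, rule_format, of UNIV x] by auto
    then obtain e where "e > 0" "ball x e \<subseteq> U" by (meson open_contains_ball)
    with UV show ?thesis by blast
  qed
  then obtain e C where eC: "\<And>x. e x > (0::real)" "\<And>x. compact (C x)" "\<And>x :: 'a. ball x (e x) \<subseteq> C x"
    by metis
  have "K \<subseteq> (\<Union>x\<in>K. ball x (e x / 2))" using eC(1) by (auto intro!: exI)
  then obtain F where F: "F \<subseteq> K" "finite F" "K \<subseteq> (\<Union>x\<in>F. ball x (e x / 2))"
    using compactE_image[OF K, of K "\<lambda>x. ball x (e x / 2)"] by auto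
  define d where "d = Min (insert 1 ((\<lambda>x. e x / 4) ` F))"
  have "d > 0" using F(2) eC(1) by (auto simp: d_def)
  moreover have "d \<le> e x / 4" if "x \<in> F" for x
    unfolding d_def by (rule Min_le) (use F(2) that in auto)
  ultimately have d: "d > 0" "\<And>x. x \<in> F \<Longrightarrow> d \<le> e x / 4" by auto
  have "cball x d \<subseteq> (\<Union>x\<in>F. C x)" if x: "x \<in> K" for x
  proof
    fix y assume y: "y \<in> cball x d"
    obtain z where z: "z \<in> F" "dist z x < e z / 2" using F(3) x by auto
    have "dist z y < e z"
      using dist_triangle[of z y x] y z d(2)[OF z(1)] eC(1)[of z] by (simp; linarith)
    then show "y \<in> (\<Union>x\<in>F. C x)" using eC(3) z(1) by (auto simp: subset_iff)
  qed
  moreover have "compact (\<Union>x\<in>F. C x)" using F(2) eC(2) by blast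
  ultimately show ?thesis using d(1) by blast
qed

text \<open>The Hopf-Rinow theorem.  Let \<open>S\<close> be the supremum of the radii of compact balls around \<open>x\<close>.
  Every point of the ball of radius \<open>S\<close> is close to a slightly smaller, compact ball, since one
  can move towards \<open>x\<close> along a segment; so the ball of radius \<open>S\<close> is totally bounded, and compact by
  completeness.  Its compact enlargement then contains a strictly larger ball.\<close>

lemma compact_cball:
  fixes x :: 'a
  shows "compact (cball x r)"
proof (rule ccontr)
  assume nr: "\<not> compact (cball x r)"
  define R where "R = {s. s \<ge> 0 \<and> compact (cball x s)}"
  have down: "s \<in> R" if "t \<in> R" "0 \<le> s" "s \<le> t" for s t
    using that compact_Int_closed[of "cball x t" "cball x s"]
    by (auto simp: R_def Int_absorb1 subset_cball)
  have r: "r \<ge> 0" using nr by (cases "r < 0") auto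
  have bdd: "s \<le> r" if "s \<in> R" for s
    using down[OF that r] nr unfolding R_def by fastforce
  have "0 \<in> R" by (simp add: R_def)
  have bR: "bdd_above R" using bdd unfolding bdd_above_def by blast
  define S where "S = Sup R"
  have S0: "0 \<le> S" unfolding S_def by (rule cSup_upper[OF \<open>0 \<in> R\<close> bR])
  have below: "s \<in> R" if s: "0 \<le> s" "s < S" for s
  proof -
    obtain t where "t \<in> R" "s < t"
      using s(2) less_cSup_iff[of R s] \<open>0 \<in> R\<close> bR unfolding S_def by auto
    then show ?thesis using down s by auto
  qed
  have pull: "\<exists>z. dist x z \<le> s \<and> dist z y \<le> d" if "dist x y \<le> s + d" "0 \<le> s" "0 \<le> d" for y s d
  proof (cases "dist x y \<le> s")
    case True then show ?thesis using that(3) by (intro exI[of _ y]) auto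
  next
    case False
    then have pos: "0 < dist x y" using that by linarith
    have "dist x (seg x y (s / dist x y)) = s" "dist (seg x y (s / dist x y)) y = dist x y - s"
      using False pos that by (subst dist_seg_left dist_seg_right; simp add: field_simps)+
    then show ?thesis using that by (intro exI[of _ "seg x y (s / dist x y)"]) auto
  qed
  have "compact (cball x S)"
    unfolding compact_eq_totally_bounded
  proof (intro conjI allI impI)
    show "complete (cball x S)"
      using complete complete_closed_subset[of "cball x S" UNIV] by simp
    fix e :: real assume e: "0 < e"
    define s where "s = max 0 (S - e/3)"
    have "s \<in> R"
      by (cases "S = 0") (use below[of s] \<open>0 \<in> R\<close> e S0 in \<open>auto simp: s_def max_def\<close>)
    then have "compact (cball x s)" by (simp add: R_def)
    then obtain k where k: "finite k" "cball x s \<subseteq> (\<Union>z\<in>k. ball z (e/2))"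
      using e unfolding compact_eq_totally_bounded by (meson half_gt_zero)
    have "cball x S \<subseteq> (\<Union>z\<in>k. ball z e)"
    proof
      fix y assume "y \<in> cball x S"
      then have "dist x y \<le> s + e/3" by (auto simp: s_def)
      then obtain z where z: "dist x z \<le> s" "dist z y \<le> e/3"
        using pull[of y s "e/3"] e by (auto simp: s_def)
      then obtain w where w: "w \<in> k" "dist w z < e/2" using k(2) by (auto simp: subset_iff)
      then show "y \<in> (\<Union>z\<in>k. ball z e)"
        using dist_triangle[of w y z] z e by (intro UN_I[of w]) auto
    qed
    then show "\<exists>k. finite k \<and> cball x S \<subseteq> (\<Union>x\<in>k. ball x e)" using k(1) by blast
  qed
  then obtain e C where e: "e > 0" "compact C" "\<And>y. y \<in> cball x S \<Longrightarrow> cball y e \<subseteq> C"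
    using compact_enlarge by metis
  have "cball x (S + e) \<subseteq> C"
  proof
    fix y assume "y \<in> cball x (S + e)"
    then obtain z where "dist x z \<le> S" "dist z y \<le> e" using pull[of y S e] e(1) S0 by auto
    then show "y \<in> C" using e(3)[of z] by auto
  qed
  then have "compact (cball x (S + e))"
    using e(2) compact_Int_closed[of C "cball x (S + e)"] by (auto simp: Int_absorb1)
  then have "S + e \<in> R" using S0 e(1) by (simp add: R_def)
  then have "S + e \<le> S" unfolding S_def by (rule cSup_upper[OF _ bR])
  with e(1) show False by simp
qed

end

section \<open>Normalized limits of distance functions\<close>

text \<open>The points of the coarse closure, with each class represented by its member that vanishes
  at \<open>x0\<close>: the limits, uniform on compact sets, of the functions \<open>|xy| - |x0 y|\<close>.\<close>

definition distance_limit :: "'a::metric_space \<Rightarrow> ('a \<Rightarrow> real) \<Rightarrow> bool" where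
  "distance_limit x0 f \<longleftrightarrow> f x0 = 0 \<and>
     (\<forall>K e. compact K \<longrightarrow> 0 < e \<longrightarrow> (\<exists>y. \<forall>x\<in>K. \<bar>dist x y - dist x0 y - f x\<bar> < e))"

lemma distance_limitD:
  assumes "distance_limit x0 f" "compact K" "0 < e"
  obtains y where "\<And>x. x \<in> K \<Longrightarrow> dist x y - dist x0 y < f x + e"
    "\<And>x. x \<in> K \<Longrightarrow> f x < dist x y - dist x0 y + e"
proof -
  obtain y where y: "\<forall>x\<in>K. \<bar>dist x y - dist x0 y - f x\<bar> < e"
    using assms unfolding distance_limit_def by blast
  show thesis
  proof (rule that)
    fix x assume "x \<in> K"
    with y have "\<bar>dist x y - dist x0 y - f x\<bar> < e" by blast
    then show "dist x y - dist x0 y < f x + e" "f x < dist x y - dist x0 y + e" by linarith+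
  qed
qed

lemma distance_limit_dist: "distance_limit x0 (\<lambda>x. dist x y - dist x0 y)"
  unfolding distance_limit_def by (auto intro: exI[of _ y])

lemma distance_limit_lipschitz:
  assumes "distance_limit x0 f"
  shows "f x - f z \<le> dist x z"
proof (rule field_le_epsilon)
  fix e :: real assume "0 < e"
  then obtain y where y: "dist z y - dist x0 y < f z + e / 2" "f x < dist x y - dist x0 y + e / 2"
    using distance_limitD[OF assms, of "{x, z}" "e / 2"] by (metis finite.emptyI
        finite_imp_compact finite_insert half_gt_zero insertCI)
  show "f x - f z \<le> dist x z + e"
    using y dist_triangle[of x y z] by linarith
qed

lemma distance_limit_continuous:
  assumes "distance_limit x0 f"
  shows "continuous_on S f"
proof -
  have "dist (f x) (f z) \<le> dist x z" for x z
    using distance_limit_lipschitz[OF assms, of x z] distance_limit_lipschitz[OF assms, of z x]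
    by (simp add: dist_real_def dist_commute abs_le_iff)
  then show ?thesis unfolding continuous_on_iff by (meson le_less_trans)
qed

lemma distance_limit_lower:
  assumes "distance_limit x0 f"
  shows "- dist x0 x \<le> f x"
  using distance_limit_lipschitz[OF assms, of x0 x] assms by (simp add: distance_limit_def)

section \<open>Gradient points\<close>

text \<open>A limit of distance functions decreases at most at unit speed away from \<open>x0\<close>, so the value
  \<open>- t\<close> is the least conceivable one on the closed ball of radius \<open>t\<close>.  A gradient point attains it.  For
  \<open>|xy| - |x0 y|\<close> and \<open>t \<le> |x0 y|\<close> the gradient point is the point at distance \<open>t\<close> from \<open>x0\<close> on \<open>[x0 y]\<close>; for a limit
  at infinity the gradient points trace the ray that the projection assigns to it.\<close>

definition gradient_point :: "'a::metric_space \<Rightarrow> ('a \<Rightarrow> real) \<Rightarrow> real \<Rightarrow> 'a \<Rightarrow> bool" where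
  "gradient_point x0 f t p \<longleftrightarrow> dist x0 p \<le> t \<and> f p \<le> - t"

definition descent_ray :: "'a::metric_space \<Rightarrow> ('a \<Rightarrow> real) \<Rightarrow> real \<Rightarrow> 'a" where
  "descent_ray x0 f t = (THE p. gradient_point x0 f t p)"

lemma gradient_point_eq:
  assumes "distance_limit x0 f" "gradient_point x0 f t p"
  shows "dist x0 p = t" "f p = - t"
  using distance_limit_lower[OF assms(1), of p] assms(2) by (auto simp: gradient_point_def)

context connected_busemann
begin

text \<open>Convexity of the distance to a point passes to limits.\<close>

lemma distance_limit_convex:
  fixes x0 :: 'a
  assumes f: "distance_limit x0 f" and t: "0 \<le> t" "t \<le> 1"
  shows "f (seg p q t) \<le> (1 - t) * f p + t * f q"
proof (rule field_le_epsilon)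
  fix e :: real assume e: "0 < e"
  define h where "h = e / 2"
  have "compact {p, q, seg p q t}" "0 < h" using e by (auto simp: h_def)
  from distance_limitD[OF f this] obtain y where
    y: "\<And>w. w \<in> {p, q, seg p q t} \<Longrightarrow> dist w y - dist x0 y < f w + h"
      "\<And>w. w \<in> {p, q, seg p q t} \<Longrightarrow> f w < dist w y - dist x0 y + h" by blast
  have "(1 - t) * (dist p y - dist x0 y) \<le> (1 - t) * (f p + h)"
    "t * (dist q y - dist x0 y) \<le> t * (f q + h)"
    using y(1)[of p] y(1)[of q] t by (intro mult_left_mono; simp)+
  then have "(1 - t) * dist p y + t * dist q y - dist x0 y \<le> (1 - t) * f p + t * f q + h"
    by (simp add: algebra_simps)
  moreover have "f (seg p q t) < dist (seg p q t) y - dist x0 y + h" by (rule y(2)) simp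
  ultimately show "f (seg p q t) \<le> (1 - t) * f p + t * f q + e"
    using dist_convex[OF t, of p q y] e unfolding h_def by linarith
qed

text \<open>By convexity the midpoint \<open>m\<close> of two gradient points also satisfies \<open>f m \<le> - t\<close>, hence
  \<open>|x0 m| \<ge> t\<close>, which strict convexity of balls allows only if the two points agree.  This is
  what makes a limit of distance functions determine a single ray.\<close>

lemma gradient_point_unique:
  fixes x0 :: 'a
  assumes f: "distance_limit x0 f" and p: "gradient_point x0 f t p" and q: "gradient_point x0 f t q"
  shows "p = q"
proof (rule balls_strictly_convex)
  show "dist x0 p \<le> t" "dist x0 q \<le> t" using p q by (auto simp: gradient_point_def)
  have "f (seg p q (1/2)) \<le> (1 - 1/2) * f p + 1/2 * f q"
    by (rule distance_limit_convex[OF f]) auto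
  then have "f (seg p q (1/2)) \<le> - t" using p q by (simp add: gradient_point_def)
  then show "t \<le> dist x0 (seg p q (1/2))"
    using distance_limit_lower[OF f, of "seg p q (1/2)"] by linarith
qed

lemma gradient_point_seg:
  fixes x0 :: 'a
  assumes f: "distance_limit x0 f" and p: "gradient_point x0 f t p" and s: "0 \<le> s" "s \<le> t" "0 < t"
  shows "gradient_point x0 f s (seg x0 p (s / t))"
proof -
  have st: "0 \<le> s / t" "s / t \<le> 1" using s by auto
  have "f x0 = 0" using f by (simp add: distance_limit_def)
  then have "f (seg x0 p (s / t)) \<le> s / t * f p"
    using distance_limit_convex[OF f st, of x0 p] by simp
  then show ?thesis
    using dist_seg_left[OF st, of x0 p] gradient_point_eq[OF f p] s
    by (simp add: gradient_point_def)
qed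

lemma seg_from_base:
  fixes x0 y :: 'a
  assumes "0 \<le> s" "s \<le> dist x0 y"
  obtains q where "dist x0 q = s" "dist q y = dist x0 y - s" 
proof (cases "dist x0 y = 0")
  case True
  with assms show ?thesis by (intro that[of x0]) auto
next
  case False
  then have "s / dist x0 y \<le> 1" "0 \<le> s / dist x0 y" using assms by (auto simp: divide_simps)
  from dist_seg_left[OF this(2,1), of x0 y] dist_seg_right[OF this(2,1), of x0 y] False
  show ?thesis by (intro that[of "seg x0 y (s / dist x0 y)"]) (auto simp: left_diff_distrib)
qed

end

context proper_busemann
begin

text \<open>If \<open>f x\<close> is almost \<open>- t\<close> or less, an approximating \<open>y\<close> has \<open>|x0 y|\<close> almost \<open>t\<close> or more, and the point
  of \<open>[x0 y]\<close> at distance \<open>t\<close> (or \<open>y\<close> itself) almost has the value \<open>- t\<close>.  Compactness of the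
  ball turns these near minimizers into a minimizer.\<close>

lemma gradient_point_exists:
  fixes x0 :: 'a
  assumes f: "distance_limit x0 f" and t: "0 \<le> t"
    and inf: "\<And>d. 0 < d \<Longrightarrow> \<exists>x. f x < - t + d"
  shows "\<exists>p. gradient_point x0 f t p"
proof -
  have near: "\<exists>q\<in>cball x0 t. f q \<le> - t + d" if d: "0 < d" for d
  proof -
    obtain x where x: "f x < - t + d / 3" using inf[of "d / 3"] d by auto
    have "compact (insert x (cball x0 t))" "0 < d / 3" using d compact_cball by auto
    from distance_limitD[OF f this] obtain y where
      y: "\<And>w. w \<in> insert x (cball x0 t) \<Longrightarrow> dist w y - dist x0 y < f w + d / 3"
        "\<And>w. w \<in> insert x (cball x0 t) \<Longrightarrow> f w < dist w y - dist x0 y + d / 3" by blast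
    define s where "s = min t (dist x0 y)"
    obtain q where q: "dist x0 q = s" "dist q y = dist x0 y - s"
      using seg_from_base[of s x0 y] t by (auto simp: s_def)
    have "dist x0 y > t - 2 * d / 3" using y(1)[of x] x zero_le_dist[of x y] insertI1[of x "cball x0 t"] by linarith
    then have "s > t - 2 * d / 3" using d by (auto simp: s_def)
    moreover have qb: "q \<in> cball x0 t" using q by (auto simp: s_def)
    ultimately have "f q \<le> - t + d" using y(2)[of q] q by simp
    with qb show ?thesis by blast
  qed
  obtain p where p: "p \<in> cball x0 t" "\<And>q. q \<in> cball x0 t \<Longrightarrow> f p \<le> f q"
    using continuous_attains_inf[OF compact_cball _ distance_limit_continuous[OF f], of x0 t] t
    by (auto simp: cball_eq_empty)
  have "f p \<le> - t"
  proof (rule field_le_epsilon)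
    fix d :: real assume "0 < d"
    with near p(2) show "f p \<le> - t + d" by (meson order_trans)
  qed
  with p(1) show ?thesis by (auto simp: gradient_point_def)
qed

text \<open>Points of the ball away from the unique minimizer form a compact set, on which \<open>f\<close> exceeds its
  minimum by a definite amount.  So near minimizers, in particular gradient points of nearby
  functions, are near \<open>p\<close>.  Continuity of the projection rests on this.\<close>

lemma gradient_point_stable:
  fixes x0 :: 'a
  assumes f: "distance_limit x0 f" and p: "gradient_point x0 f t p" and e: "0 < e"
  obtains d where "0 < d" "\<And>q. dist x0 q \<le> t \<Longrightarrow> f q < - t + d \<Longrightarrow> dist q p < e"
proof -
  let ?C = "cball x0 t \<inter> {q. e \<le> dist q p}"
  have "closed {q. e \<le> dist q p}" by (intro closed_Collect_le continuous_intros)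
  then have C: "compact ?C" using compact_cball by (intro compact_Int_closed)
  show thesis
  proof (cases "?C = {}")
    case True
    then show thesis by (intro that[of 1]) (auto simp: not_le[symmetric])
  next
    case False
    then obtain r where r: "r \<in> ?C" "\<And>q. q \<in> ?C \<Longrightarrow> f r \<le> f q"
      using continuous_attains_inf[OF C _ distance_limit_continuous[OF f]] by blast
    have "- t < f r"
    proof (rule ccontr)
      assume "\<not> - t < f r"
      with r(1) have "gradient_point x0 f t r" by (auto simp: gradient_point_def)
      with gradient_point_unique[OF f p] r(1) e show False by auto
    qed
    then show thesis
    proof (intro that[of "f r + t"])
      fix q assume "dist x0 q \<le> t" "f q < - t + (f r + t)"
      then show "dist q p < e" using r(2)[of q] by (cases "dist q p < e") auto
    qed simp
  qed
qed

text \<open>A limit that is bounded below comes from a point of the space.  With \<open>- R\<close> the infimum of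
  \<open>f\<close>, every good approximation \<open>|xy| - |x0 y|\<close> has \<open>|x0 y| \<le> R + 1\<close>, since otherwise \<open>[x0 y]\<close>
  would leave the ball of radius \<open>R\<close> and take \<open>f\<close> below \<open>- R\<close>.  Then \<open>y\<close> is itself a point at which the
  approximation may be tested, and it turns out to be near the gradient point \<open>p\<close> of level \<open>R\<close>.\<close>

lemma distance_limit_bounded_below:
  fixes x0 :: 'a
  assumes f: "distance_limit x0 f" and B: "\<And>x. B \<le> f x"
  shows "\<exists>p. f = (\<lambda>x. dist x p - dist x0 p)"
proof -
  have f0: "f x0 = 0" using f by (simp add: distance_limit_def)
  define R where "R = - (INF x. f x)"
  have bdd: "bdd_below (range f)" using B by (rule bdd_belowI2)
  have lower: "- R \<le> f x" for x unfolding R_def using bdd by (simp add: cINF_lower)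
  have R0: "0 \<le> R" using lower[of x0] f0 by simp
  have "\<exists>x. f x < - R + d" if "0 < d" for d
    using cInf_lessD[of "range f" "- R + d"] that unfolding R_def by auto
  then obtain p where p: "gradient_point x0 f R p" using gradient_point_exists[OF f R0] by blast
  have "\<bar>dist x p - dist x0 p - f x\<bar> \<le> e" if e: "0 < e" for x e
  proof -
    \<comment> \<open>\<open>5 d\<close> bounds the total error below; \<open>d < 1\<close> excludes approximations that reach beyond \<open>R + 1\<close>\<close>
    define d where "d = min (e / 5) (1 / 2)"
    have d: "0 < d" "d \<le> 1 / 2" "5 * d \<le> e" using e by (auto simp: d_def)
    have "compact (insert x (cball x0 (R + 1)))" using compact_cball by auto
    from distance_limitD[OF f this d(1)] obtain y where
      y: "\<And>w. w \<in> insert x (cball x0 (R + 1)) \<Longrightarrow> dist w y - dist x0 y < f w + d"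
        "\<And>w. w \<in> insert x (cball x0 (R + 1)) \<Longrightarrow> f w < dist w y - dist x0 y + d" by blast
    have "dist x0 y \<le> R + 1"
    proof (rule ccontr)
      assume "\<not> dist x0 y \<le> R + 1"
      then obtain q where q: "dist x0 q = R + 1" "dist q y = dist x0 y - (R + 1)"
        using seg_from_base[of "R + 1" x0 y] R0 by auto
      show False using y(2)[of q] q lower[of q] d by simp
    qed
    then have "dist x0 y < R + d" using y(2)[of y] lower[of y] by simp
    moreover have "dist x0 p = R" "f p = - R" using gradient_point_eq[OF f p] by auto
    ultimately have py: "dist p y < 2 * d" using y(1)[of p] by simp
    show ?thesis
      using y(1)[OF insertI1] y(2)[OF insertI1] py d(3)
        dist_triangle[of x p y] dist_triangle[of x y p]
        dist_triangle[of x0 p y] dist_triangle[of x0 y p] dist_commute[of y p]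
      by linarith
  qed
  then have le: "\<bar>dist x p - dist x0 p - f x\<bar> \<le> 0" for x
    by (rule field_le_epsilon) (simp only: add_0)
  have "f x = dist x p - dist x0 p" for x using le[of x] by linarith
  then show ?thesis by blast
qed

text \<open>The point at distance \<open>s\<close> on the segment from \<open>x0\<close> to a gradient point of level \<open>t\<close> is a gradient point
  of level \<open>s\<close>, so by uniqueness all gradient points lie on one ray.\<close>

lemma
  fixes x0 :: 'a
  assumes f: "distance_limit x0 f" and unb: "\<And>B. \<exists>x. f x < B"
  shows descent_ray_gradient: "0 \<le> t \<Longrightarrow> gradient_point x0 f t (descent_ray x0 f t)"
    and ray_descent_ray: "ray (descent_ray x0 f)"
    and descent_ray_0: "descent_ray x0 f 0 = x0"
proof -
  have grad: "gradient_point x0 f t (descent_ray x0 f t)" if t: "0 \<le> t" for t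
  proof -
    obtain p where p: "gradient_point x0 f t p"
      using gradient_point_exists[OF f t] unb by blast
    show ?thesis
      unfolding descent_ray_def by (rule theI, rule p) (rule gradient_point_unique[OF f _ p])
  qed
  then show "0 \<le> t \<Longrightarrow> gradient_point x0 f t (descent_ray x0 f t)" .
  show "descent_ray x0 f 0 = x0" using grad[of 0] by (simp add: gradient_point_def)
  have *: "dist (descent_ray x0 f s) (descent_ray x0 f t) = t - s" if "0 \<le> s" "s \<le> t" for s t
  proof (cases "t = 0")
    case False
    with that have t: "0 < t" "0 \<le> s / t" "s / t \<le> 1" by auto
    let ?p = "descent_ray x0 f t"
    have p: "gradient_point x0 f t ?p" using grad that by simp
    have "descent_ray x0 f s = seg x0 ?p (s / t)"
      by (rule gradient_point_unique[OF f grad gradient_point_seg[OF f p]]) (use that t in auto)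
    then have "dist (descent_ray x0 f s) ?p = (1 - s / t) * t"
      using dist_seg_right[OF t(2,3), of x0 ?p] gradient_point_eq[OF f p] by simp
    with t show ?thesis by (simp add: left_diff_distrib)
  qed (use that in auto)
  show "ray (descent_ray x0 f)"
    unfolding ray_def
  proof (intro allI impI)
    fix s t :: real assume "0 \<le> s" "0 \<le> t"
    with *[of s t] *[of t s] show "dist (descent_ray x0 f s) (descent_ray x0 f t) = \<bar>s - t\<bar>"
      by (cases "s \<le> t") (auto simp: dist_commute)
  qed
qed

end

section \<open>Rays and asymptoticity\<close>

lemma rayD: "ray c \<Longrightarrow> 0 \<le> s \<Longrightarrow> 0 \<le> t \<Longrightarrow> dist (c s) (c t) = \<bar>s - t\<bar>"
  by (simp add: ray_def)

text \<open>A point \<open>c' s\<close> that is close to \<open>c t\<close> has \<open>s\<close> close to \<open>t\<close>, by comparing distances to the initial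
  points; so finite Hausdorff distance already bounds the distance at equal parameters.\<close>

lemma asymptotic_rel_iff:
  "(c, c') \<in> asymptotic_rel \<longleftrightarrow> ray c \<and> ray c' \<and> (\<exists>D. \<forall>t\<ge>0. dist (c t) (c' t) \<le> D)"
proof (safe)
  assume "(c, c') \<in> asymptotic_rel"
  then show r: "ray c" "ray c'" by (auto simp: asymptotic_rel_def)
  from \<open>(c, c') \<in> asymptotic_rel\<close> obtain D where
    D: "\<forall>a\<in>c ` {0..}. \<exists>b\<in>c' ` {0..}. dist a b \<le> D"
    by (auto simp: asymptotic_rel_def finite_hausdorff_distance_def)
  have "dist (c t) (c' t) \<le> 2 * D + dist (c 0) (c' 0)" if t: "0 \<le> t" for t
  proof -
    obtain s where s: "0 \<le> s" "dist (c t) (c' s) \<le> D" using D t by auto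
    have "dist (c 0) (c t) = t" "dist (c' 0) (c' s) = s" "dist (c' s) (c' t) = \<bar>s - t\<bar>"
      using rayD[OF r(1), of 0 t] rayD[OF r(2), of 0 s] rayD[OF r(2), of s t] s t by auto
    then have "\<bar>s - t\<bar> \<le> D + dist (c 0) (c' 0)"
      using s(2) dist_triangle[of "c 0" "c t" "c' 0"] dist_triangle[of "c' 0" "c t" "c' s"]
        dist_triangle[of "c' 0" "c' s" "c 0"] dist_triangle[of "c 0" "c' s" "c t"]
      by (simp add: dist_commute abs_le_iff)
    then show ?thesis
      using \<open>dist (c' s) (c' t) = \<bar>s - t\<bar>\<close> s(2) dist_triangle[of "c t" "c' t" "c' s"] by linarith
  qed
  then show "\<exists>D. \<forall>t\<ge>0. dist (c t) (c' t) \<le> D" by blast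
next
  fix D assume r: "ray c" "ray c'" and D: "\<forall>t\<ge>0. dist (c t) (c' t) \<le> D"
  have "finite_hausdorff_distance (c ` {0..}) (c' ` {0..})"
    unfolding finite_hausdorff_distance_def by (rule exI[of _ D]) (use D in force)
  with r show "(c, c') \<in> asymptotic_rel" by (simp add: asymptotic_rel_def)
qed

lemma equiv_asymptotic_rel: "equiv {c :: real \<Rightarrow> 'a::metric_space. ray c} asymptotic_rel"
  (is "equiv ?A ?R")
proof (rule equivI)
  show "?R \<subseteq> ?A \<times> ?A" by (auto simp: asymptotic_rel_iff)
  show "refl_on ?A ?R"
    by (rule refl_onI) (auto simp: asymptotic_rel_iff)
  show "sym ?R" by (rule symI) (auto simp: asymptotic_rel_iff dist_commute)
  show "trans ?R"
  proof (rule transI)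
    fix a b c :: "real \<Rightarrow> 'a"
    assume ab: "(a, b) \<in> asymptotic_rel" and bc: "(b, c) \<in> asymptotic_rel"
    then obtain D E where "\<forall>t\<ge>0. dist (a t) (b t) \<le> D" "\<forall>t\<ge>0. dist (b t) (c t) \<le> E"
      by (auto simp: asymptotic_rel_iff)
    then have "dist (a t) (c t) \<le> D + E" if "0 \<le> t" for t
      using that dist_triangle[of "a t" "c t" "b t"] add_mono order_trans by blast
    with ab bc show "(a, c) \<in> asymptotic_rel" unfolding asymptotic_rel_iff by blast
  qed
qed

text \<open>For rays with a common origin the distance at \<open>t\<close> is at most \<open>t/u\<close> times the distance at \<open>u\<close>, and
  boundedness forces it to vanish as \<open>u\<close> grows.\<close>

lemma (in connected_busemann) asymptotic_rays_eq:
  fixes c c' :: "real \<Rightarrow> 'a"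
  assumes "(c, c') \<in> asymptotic_rel" and eq: "c 0 = c' 0" and t: "0 \<le> t"
  shows "c t = c' t"
proof -
  obtain D where r: "ray c" "ray c'" and D: "\<And>t. 0 \<le> t \<Longrightarrow> dist (c t) (c' t) \<le> D"
    using assms(1) by (auto simp: asymptotic_rel_iff)
  have bound: "dist (c t) (c' t) \<le> t * D / real (Suc n)" if n: "t \<le> real (Suc n)" for n
  proof -
    let ?u = "real (Suc n)"
    have "c t = seg (c 0) (c ?u) (t / ?u)"
      by (rule isometric_eq_seg[where L = ?u]) (use rayD[OF r(1)] t n in auto)
    moreover have "c' t = seg (c' 0) (c' ?u) (t / ?u)"
      by (rule isometric_eq_seg[where L = ?u]) (use rayD[OF r(2)] t n in auto)
    moreover have "dist (seg (c 0) (c ?u) (t / ?u)) (seg (c 0) (c' ?u) (t / ?u))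
        \<le> t / ?u * dist (c ?u) (c' ?u)"
      by (rule seg_convex) (use t n in auto)
    moreover have "t / ?u * dist (c ?u) (c' ?u) \<le> t / ?u * D"
      using D[of ?u] t by (intro mult_left_mono) auto
    ultimately show ?thesis using eq by simp
  qed
  have "(\<lambda>n. t * D / real (Suc n)) \<longlonglongrightarrow> 0"
    using LIMSEQ_Suc[OF lim_const_over_n[of "t * D"]] by simp
  moreover have "\<exists>N. \<forall>n\<ge>N. dist (c t) (c' t) \<le> t * D / real (Suc n)"
  proof -
    obtain N where "t \<le> real N" using real_arch_simple by blast
    then show ?thesis by (intro exI[of _ N] allI impI bound) linarith
  qed
  ultimately have "dist (c t) (c' t) \<le> 0" by (rule LIMSEQ_le_const)
  then show ?thesis by simp
qed

section \<open>Busemann functions and change of the initial point\<close>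

text \<open>On a finite net pointwise convergence is uniform, and the Lipschitz bound controls the rest.\<close>

lemma lipschitz_pointwise_limit_uniform:
  fixes g :: "nat \<Rightarrow> 'a::metric_space \<Rightarrow> real"
  assumes lip: "\<And>n x z. g n x - g n z \<le> dist x z"
    and lim: "\<And>x. (\<lambda>n. g n x) \<longlonglongrightarrow> f x"
    and K: "compact K" and e: "0 < e"
  shows "\<forall>\<^sub>F n in sequentially. \<forall>x\<in>K. \<bar>g n x - f x\<bar> < e"
proof -
  have lip_f: "f x - f z \<le> dist x z" for x z
    by (rule LIMSEQ_le_const2[OF tendsto_diff[OF lim[of x] lim[of z]]]) (auto intro: lip)
  have "K \<subseteq> (\<Union>x\<in>K. ball x (e / 3))" using e by auto
  then obtain F where F: "F \<subseteq> K" "finite F" "K \<subseteq> (\<Union>x\<in>F. ball x (e / 3))"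
    using compactE_image[OF K, of K "\<lambda>x. ball x (e / 3)"] by auto
  have "\<forall>\<^sub>F n in sequentially. \<forall>z\<in>F. dist (g n z) (f z) < e / 3"
    using F(2) tendstoD[OF lim, of "e / 3"] e by (intro eventually_ball_finite) auto
  then show ?thesis
  proof eventually_elim
    case (elim n)
    show ?case
    proof
      fix x assume "x \<in> K"
      then obtain z where z: "z \<in> F" "dist z x < e / 3" using F(3) by auto
      then have "\<bar>g n z - f z\<bar> < e / 3" using elim by (auto simp: dist_real_def)
      then show "\<bar>g n x - f x\<bar> < e"
        using lip[of n x z] lip[of n z x] lip_f[of x z] lip_f[of z x] z(2) dist_commute[of x z]
        by linarith
    qed
  qed
qed

text \<open>The Busemann function of the ray, normalized at \<open>x0\<close>.  The differences \<open>|x c(n)| - n\<close> decrease in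
  \<open>n\<close> and are bounded below by the triangle inequality, so they converge.  Two uses: it realizes every
  boundary point of the weak closure by a limit of distance functions, and it moves rays to a new
  initial point.\<close>

lemma ray_busemann_function:
  fixes x0 :: "'a::metric_space"
  assumes c: "ray c"
  obtains f where "distance_limit x0 f"
    "\<And>K e. compact K \<Longrightarrow> 0 < e \<Longrightarrow>
      \<forall>\<^sub>F n in sequentially. \<forall>x\<in>K. \<bar>dist x (c (real n)) - dist x0 (c (real n)) - f x\<bar> < e"
    "\<And>t. 0 \<le> t \<Longrightarrow> f (c t) = f (c 0) - t"
proof -
  define g where "g x n = dist x (c (real n)) - real n" for x n
  have "\<exists>L. g x \<longlonglongrightarrow> L" for x
  proof -
    have "decseq (g x)"
    proof (rule decseq_SucI)
      fix n
      have "dist (c (real n)) (c (real (Suc n))) = 1" using rayD[OF c, of "real n" "real (Suc n)"] by simp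
      then show "g x (Suc n) \<le> g x n"
        using dist_triangle[of x "c (real (Suc n))" "c (real n)"] by (simp add: g_def)
    qed
    moreover have "- dist x (c 0) \<le> g x n" for n
      using rayD[OF c, of 0 "real n"] dist_triangle[of "c 0" "c (real n)" x]
      by (simp add: g_def dist_commute)
    ultimately show ?thesis using decseq_convergent[of "g x" "- dist x (c 0)"] by blast
  qed
  then obtain b where b: "\<And>x. g x \<longlonglongrightarrow> b x" by metis
  define f where "f x = b x - b x0" for x
  have lim: "(\<lambda>n. dist x (c (real n)) - dist x0 (c (real n))) \<longlonglongrightarrow> f x" for x
    using tendsto_diff[OF b[of x] b[of x0]] by (simp add: g_def f_def)
  have unif: "\<forall>\<^sub>F n in sequentially. \<forall>x\<in>K. \<bar>dist x (c (real n)) - dist x0 (c (real n)) - f x\<bar> < e"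
    if "compact K" "0 < e" for K e
  proof (rule lipschitz_pointwise_limit_uniform[OF _ lim that])
    fix n x z
    show "dist x (c (real n)) - dist x0 (c (real n)) - (dist z (c (real n)) - dist x0 (c (real n)))
        \<le> dist x z"
      using dist_triangle[of x "c (real n)" z] by simp
  qed
  have "distance_limit x0 f"
    unfolding distance_limit_def
  proof (intro conjI allI impI)
    show "f x0 = 0" by (simp add: f_def)
    fix K :: "'a set" and e :: real assume "compact K" "0 < e"
    from eventually_happens'[OF sequentially_bot unif[OF this]]
    show "\<exists>y. \<forall>x\<in>K. \<bar>dist x y - dist x0 y - f x\<bar> < e" by blast
  qed
  moreover have "b (c t) = - t" if t: "0 \<le> t" for t
  proof -
    obtain N where N: "t \<le> real N" using real_arch_simple by blast
    have "\<forall>\<^sub>F n in sequentially. g (c t) n = - t"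
      using eventually_ge_at_top[of N]
    proof eventually_elim
      case (elim n)
      then show ?case using rayD[OF c t, of "real n"] N by (simp add: g_def)
    qed
    then show ?thesis using b[of "c t"] tendsto_eventually LIMSEQ_unique by blast
  qed
  then have "f (c t) = f (c 0) - t" if "0 \<le> t" for t
    using that by (simp add: f_def)
  ultimately show thesis using that[OF _ unif] by blast
qed

context connected_busemann
begin

lemma dist_seg_seg:
  fixes x y :: 'a
  assumes s: "0 \<le> s" "s \<le> 1" and t: "0 \<le> t" "t \<le> 1"
  shows "dist (seg x y s) (seg x y t) = \<bar>s - t\<bar> * dist x y"
proof -
  obtain c where c: "c 0 = x" "c (dist x y) = y"
    "\<And>s u. 0 \<le> s \<Longrightarrow> s \<le> dist x y \<Longrightarrow> 0 \<le> u \<Longrightarrow> u \<le> dist x y \<Longrightarrow> dist (c s) (c u) = \<bar>s - u\<bar>"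
    using ex_isometric_segment by blast
  have in_range: "0 \<le> r * dist x y" "r * dist x y \<le> dist x y" if "0 \<le> r" "r \<le> 1" for r
    using that by (auto intro: mult_left_le_one_le)
  have seg_c: "seg x y r = c (r * dist x y)" if r: "0 \<le> r" "r \<le> 1" for r
  proof (rule seg_eqI[OF r])
    show "dist x (c (r * dist x y)) = r * dist x y"
      using c(3)[of 0 "r * dist x y"] in_range[OF r] c(1) by simp
    show "dist (c (r * dist x y)) y = (1 - r) * dist x y"
      using c(3)[of "r * dist x y" "dist x y"] in_range[OF r] c(2) by (simp add: left_diff_distrib)
  qed
  have "dist (seg x y s) (seg x y t) = \<bar>s * dist x y - t * dist x y\<bar>"
    unfolding seg_c[OF s] seg_c[OF t] using in_range s t by (intro c(3)) auto
  then show ?thesis by (simp add: left_diff_distrib[symmetric] abs_mult)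
qed

text \<open>At equal proportions, the segments from \<open>x\<close> and \<open>p\<close> to \<open>y\<close> are at distance at most \<open>|xp|\<close>, by the
  Busemann inequality with vertex \<open>y\<close>.  Passing to equal arc lengths costs at most another
  \<open>|xp|\<close>, because the lengths of the two segments differ by no more than that.\<close>

lemma fellow_travel_to_common_end:
  fixes x p y :: 'a
  assumes t: "0 \<le> t" "t \<le> dist p y" "t \<le> dist x y" and pos: "0 < dist p y" "0 < dist x y"
  shows "dist (seg x y (t / dist x y)) (seg p y (t / dist p y)) \<le> 2 * dist x p"
proof -
  let ?l = "dist x y" and ?n = "dist p y"
  have r: "0 \<le> t / ?n" "t / ?n \<le> 1" and r': "0 \<le> t / ?l" "t / ?l \<le> 1"
    using t pos by auto
  have "dist (seg x y (t / ?n)) (seg p y (t / ?n)) \<le> (1 - t / ?n) * dist x p"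
    using seg_convex[of "1 - t / ?n" y x p] seg_commute[OF r, of x y] seg_commute[OF r, of p y] r
    by simp
  also have "\<dots> \<le> dist x p" using r by (intro mult_left_le_one_le) auto
  finally have 1: "dist (seg x y (t / ?n)) (seg p y (t / ?n)) \<le> dist x p" .
  have "dist (seg x y (t / ?l)) (seg x y (t / ?n)) = \<bar>t / ?l - t / ?n\<bar> * ?l"
    by (rule dist_seg_seg[OF r' r])
  also have "\<dots> = \<bar>t / ?l * ?l - t / ?n * ?l\<bar>"
    by (simp only: left_diff_distrib[symmetric] abs_mult abs_of_nonneg zero_le_dist)
  also have "t / ?l * ?l - t / ?n * ?l = t / ?n * (?n - ?l)"
    using pos by (simp add: right_diff_distrib)
  also have "\<bar>t / ?n * (?n - ?l)\<bar> = t / ?n * \<bar>?n - ?l\<bar>"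
    using r(1) by (simp only: abs_mult abs_of_nonneg)
  also have "\<dots> \<le> \<bar>?n - ?l\<bar>" using r by (intro mult_left_le_one_le) auto
  also have "\<dots> \<le> dist x p"
    using dist_triangle[of p y x] dist_triangle[of x y p] dist_commute[of p x] by linarith
  finally show ?thesis
    using 1 dist_triangle[of "seg x y (t / ?l)" "seg p y (t / ?n)" "seg x y (t / ?n)"] by linarith
qed

end

context proper_busemann
begin

text \<open>The gradient points of the Busemann function of \<open>c\<close>, normalized at \<open>x0\<close>, form a ray from \<open>x0\<close>.  By
  stability they are limits of the points on \<open>[x0 c(n)]\<close>, and these segments stay near \<open>c\<close>.\<close>

lemma asymptotic_ray_from:
  fixes c :: "real \<Rightarrow> 'a"
  assumes c: "ray c"
  obtains c' where "(c, c') \<in> asymptotic_rel" "c' 0 = x0"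
proof -
  obtain f where f: "distance_limit x0 f"
    and unif: "\<And>K e. compact K \<Longrightarrow> 0 < e \<Longrightarrow>
      \<forall>\<^sub>F n in sequentially. \<forall>x\<in>K. \<bar>dist x (c (real n)) - dist x0 (c (real n)) - f x\<bar> < e"
    and fc: "\<And>t. 0 \<le> t \<Longrightarrow> f (c t) = f (c 0) - t"
    by (rule ray_busemann_function[OF c, of x0]) (rule that)
  have unb: "\<exists>x. f x < B" for B
  proof
    show "f (c (\<bar>f (c 0) - B\<bar> + 1)) < B" using fc[of "\<bar>f (c 0) - B\<bar> + 1"] by simp
  qed
  let ?c = "descent_ray x0 f"
  have "dist (c t) (?c t) \<le> 2 * dist x0 (c 0) + 1" if t: "0 \<le> t" for t
  proof -
    have grad: "gradient_point x0 f t (?c t)" by (rule descent_ray_gradient[OF f unb t])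
    obtain d where d: "0 < d" "\<And>q. dist x0 q \<le> t \<Longrightarrow> f q < - t + d \<Longrightarrow> dist q (?c t) < 1"
      using gradient_point_stable[OF f grad, of 1] by auto
    \<comment> \<open>beyond \<open>N\<close> the segments from \<open>x0\<close> to \<open>c(n)\<close> are longer than \<open>t\<close>\<close>
    obtain N where N: "t + dist x0 (c 0) + 1 \<le> real N" using real_arch_simple by blast
    have "\<forall>\<^sub>F n in sequentially. N \<le> n \<and>
        (\<forall>x\<in>cball x0 t. \<bar>dist x (c (real n)) - dist x0 (c (real n)) - f x\<bar> < d)"
      using unif[OF compact_cball d(1)] eventually_ge_at_top by (intro eventually_conj)
    from eventually_happens'[OF sequentially_bot this] obtain n where n: "N \<le> n"
      "\<And>x. x \<in> cball x0 t \<Longrightarrow> \<bar>dist x (c (real n)) - dist x0 (c (real n)) - f x\<bar> < d" by auto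
    let ?y = "c (real n)"
    have p: "dist (c 0) ?y = real n" using rayD[OF c, of 0 "real n"] by simp
    have tn: "t + dist x0 (c 0) + 1 \<le> real n" using N n(1) by linarith
    have l: "t + 1 \<le> dist x0 ?y"
      using tn p dist_triangle[of "c 0" ?y x0] dist_commute[of x0 "c 0"] by linarith
    have pos: "0 < dist (c 0) ?y" "0 < dist x0 ?y" "t \<le> dist (c 0) ?y" "t \<le> dist x0 ?y"
      using p tn l t zero_le_dist[of x0 "c 0"] by linarith+
    let ?q = "seg x0 ?y (t / dist x0 ?y)"
    have r: "0 \<le> t / dist x0 ?y" "t / dist x0 ?y \<le> 1" using t pos by auto
    have q: "dist x0 ?q = t" "dist ?q ?y = dist x0 ?y - t"
      using dist_seg_left[OF r, of x0 ?y] dist_seg_right[OF r, of x0 ?y] pos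
      by (auto simp: left_diff_distrib)
    have "f ?q < - t + d" using n(2)[of ?q] q by simp
    with d(2) q have 1: "dist ?q (?c t) < 1" by simp
    have ct: "c t = seg (c 0) ?y (t / dist (c 0) ?y)"
      unfolding p by (rule isometric_eq_seg[where L = "real n"]) (use rayD[OF c] t pos p in auto)
    have "dist ?q (c t) \<le> 2 * dist x0 (c 0)"
      unfolding ct by (rule fellow_travel_to_common_end[OF t pos(3,4,1,2)])
    with 1 show ?thesis using dist_triangle3[of "c t" "?c t" ?q] by linarith
  qed
  then have "(c, ?c) \<in> asymptotic_rel"
    unfolding asymptotic_rel_iff using c ray_descent_ray[OF f unb] by blast
  then show thesis using that descent_ray_0[OF f unb] by blast
qed

section \<open>The arcs from the base point\<close>

lemma arc_from_boundary:
  fixes x0 :: 'a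
  assumes xi: "\<xi> \<in> weak_boundary"
  shows "arc_from x0 (Inr \<xi>) \<in> \<xi>" "ray (arc_from x0 (Inr \<xi>))" "arc_from x0 (Inr \<xi>) 0 = x0"
proof -
  obtain c where c: "ray c" "\<xi> = asymptotic_rel `` {c}"
    using xi unfolding weak_boundary_def by (auto elim: quotientE)
  obtain c' where "(c, c') \<in> asymptotic_rel" "c' 0 = x0" using asymptotic_ray_from[OF c(1)] .
  then have "\<exists>c. c \<in> \<xi> \<and> c 0 = x0" using c(2) by blast
  from someI_ex[OF this] show *: "arc_from x0 (Inr \<xi>) \<in> \<xi>" "arc_from x0 (Inr \<xi>) 0 = x0" by simp_all
  from *(1) c(2) show "ray (arc_from x0 (Inr \<xi>))" by (auto simp: asymptotic_rel_iff)
qed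

lemma arc_from_point:
  fixes x0 y :: 'a
  shows "geodesic_on {0..dist x0 y} (arc_from x0 (Inl y))"
    "arc_from x0 (Inl y) 0 = x0" "arc_from x0 (Inl y) (dist x0 y) = y"
proof -
  obtain c where c: "c 0 = x0" "c (dist x0 y) = y"
    "\<And>s u. 0 \<le> s \<Longrightarrow> s \<le> dist x0 y \<Longrightarrow> 0 \<le> u \<Longrightarrow> u \<le> dist x0 y \<Longrightarrow> dist (c s) (c u) = \<bar>s - u\<bar>"
    using ex_isometric_segment by blast
  have "geodesic_on {0..dist x0 y} c"
    by (rule isometric_imp_geodesic_on) (use c(3) in \<open>auto simp: is_interval_cc\<close>)
  with c have "\<exists>c. geodesic_on {0..dist x0 y} c \<and> c 0 = x0 \<and> c (dist x0 y) = y" by blast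
  from someI_ex[OF this] show "geodesic_on {0..dist x0 y} (arc_from x0 (Inl y))"
    "arc_from x0 (Inl y) 0 = x0" "arc_from x0 (Inl y) (dist x0 y) = y" by simp_all
qed

lemma arc_from_start: "z \<in> weak_closure \<Longrightarrow> arc_from x0 z 0 = (x0 :: 'a)"
  using arc_from_point(2) arc_from_boundary(3) unfolding weak_closure_def by (cases z) auto

lemma arc_from_isometric:
  fixes x0 :: 'a
  assumes z: "z \<in> weak_closure" and s: "0 \<le> s" "ereal s \<le> length_from x0 z"
    and t: "0 \<le> t" "ereal t \<le> length_from x0 z"
  shows "dist (arc_from x0 z s) (arc_from x0 z t) = \<bar>s - t\<bar>"
proof (cases z)
  case (Inl y)
  then show ?thesis
    using geodesic_on_isometric[OF arc_from_point(1), of s x0 y t] s t by simp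
next
  case (Inr \<xi>)
  then have "\<xi> \<in> weak_boundary" using z by (auto simp: weak_closure_def)
  with Inr show ?thesis using rayD[OF arc_from_boundary(2)] s t by blast
qed

lemma dist_arc_from:
  fixes x0 :: 'a
  assumes z: "z \<in> weak_closure" and t: "0 \<le> t" "ereal t \<le> length_from x0 z"
  shows "dist x0 (arc_from x0 z t) = t"
proof -
  have "ereal 0 \<le> length_from x0 z" using t by (meson ereal_less_eq(3) order_trans)
  then show ?thesis
    using arc_from_isometric[OF z _ _ t, of 0] arc_from_start[OF z] t by simp
qed

lemma arc_from_convex:
  fixes x0 :: 'a
  assumes z: "z \<in> weak_closure" and z': "z' \<in> weak_closure"
    and st: "0 \<le> s" "s \<le> t" and t: "ereal t \<le> length_from x0 z" "ereal t \<le> length_from x0 z'"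
  shows "dist (arc_from x0 z s) (arc_from x0 z' s) \<le> dist (arc_from x0 z t) (arc_from x0 z' t)"
proof (cases "s = 0")
  case True
  then show ?thesis using arc_from_start z z' by simp
next
  case False
  have eq: "arc_from x0 w s = seg x0 (arc_from x0 w t) (s / t)"
    if w: "w \<in> weak_closure" "ereal t \<le> length_from x0 w" for w
  proof -
    have "arc_from x0 w s = seg (arc_from x0 w 0) (arc_from x0 w t) (s / t)"
    proof (rule isometric_eq_seg[where L = t])
      fix a b assume "0 \<le> a" "a \<le> t" "0 \<le> b" "b \<le> t"
      moreover from this have "ereal a \<le> length_from x0 w" "ereal b \<le> length_from x0 w"
        using w(2) by (meson ereal_less_eq(3) order_trans)+
      ultimately show "dist (arc_from x0 w a) (arc_from x0 w b) = \<bar>a - b\<bar>"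
        by (intro arc_from_isometric w)
    qed (use st False in auto)
    then show ?thesis using arc_from_start[OF w(1)] by simp
  qed
  have r: "0 \<le> s / t" "s / t \<le> 1" using st False by auto
  have "dist (arc_from x0 z s) (arc_from x0 z' s)
      \<le> s / t * dist (arc_from x0 z t) (arc_from x0 z' t)"
    unfolding eq[OF z t(1)] eq[OF z' t(2)] by (rule seg_convex[OF r])
  also have "\<dots> \<le> dist (arc_from x0 z t) (arc_from x0 z' t)"
    using r by (intro mult_left_le_one_le) auto
  finally show ?thesis .
qed

end

section \<open>Steepest descent\<close>

text \<open>The relation between a normalized limit \<open>f\<close> and its projection \<open>z\<close>, covering interior and boundary
  points at once: \<open>f\<close> decreases at unit speed along \<open>[x0 z]\<close>, and the length of \<open>[x0 z]\<close> is as large as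
  \<open>- f\<close> can become.\<close>

definition steepest_descent ::
  "'a::metric_space \<Rightarrow> ('a \<Rightarrow> real) \<Rightarrow> 'a + (real \<Rightarrow> 'a) set \<Rightarrow> bool" where
  "steepest_descent x0 f z \<longleftrightarrow> z \<in> weak_closure \<and>
     (\<forall>x. ereal (- f x) \<le> length_from x0 z) \<and>
     (\<forall>t\<ge>0. ereal t \<le> length_from x0 z \<longrightarrow> f (arc_from x0 z t) = - t)"

lemma steepest_descentD:
  assumes "steepest_descent x0 f z"
  shows "z \<in> weak_closure" "ereal (- f x) \<le> length_from x0 z"
    "0 \<le> t \<Longrightarrow> ereal t \<le> length_from x0 z \<Longrightarrow> f (arc_from x0 z t) = - t"
  using assms unfolding steepest_descent_def by auto

lemma length_from_nonneg: "0 \<le> length_from x0 z"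
  by (cases z) auto

text \<open>In both cases the length is the supremum of \<open>- f\<close>: an upper bound by definition, and one that is
  approached along the arc itself.\<close>

lemma length_from_le_steepest_descent:
  assumes z: "steepest_descent x0 f z" and z': "steepest_descent x0 f z'"
  shows "length_from x0 z' \<le> length_from x0 z"
proof (rule ccontr)
  assume "\<not> ?thesis"
  then have "length_from x0 z < length_from x0 z'" by (simp only: not_le)
  from ereal_dense2[OF this] obtain t
    where t: "length_from x0 z < ereal t" "ereal t < length_from x0 z'" by blast
  have "0 < ereal t" using t(1) length_from_nonneg[of x0 z] by (rule order.strict_trans1[rotated])
  then have "f (arc_from x0 z' t) = - t" using steepest_descentD(3)[OF z'] t(2) by auto
  with steepest_descentD(2)[OF z, of "arc_from x0 z' t"] t(1) show False by auto
qed

context proper_busemann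
begin

lemma steepest_descent_gradient:
  fixes x0 :: 'a
  assumes "steepest_descent x0 f z" "0 \<le> t" "ereal t \<le> length_from x0 z"
  shows "gradient_point x0 f t (arc_from x0 z t)"
  using steepest_descentD[OF assms(1)] dist_arc_from assms(2,3) by (simp add: gradient_point_def)

lemma steepest_descent_dist:
  fixes x0 y :: 'a
  shows "steepest_descent x0 (\<lambda>x. dist x y - dist x0 y) (Inl y)"
  unfolding steepest_descent_def
proof (intro conjI allI impI)
  show *: "Inl y \<in> weak_closure" by (auto simp: weak_closure_def)
  show "ereal (- (dist x y - dist x0 y)) \<le> length_from x0 (Inl y)" for x by simp
  fix t :: real assume "0 \<le> t" "ereal t \<le> length_from x0 (Inl y)"
  with arc_from_isometric[OF *, of t x0 "dist x0 y"]
  show "dist (arc_from x0 (Inl y) t) y - dist x0 y = - t"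
    unfolding arc_from_point(3) by simp
qed

text \<open>A limit that is bounded below comes from a point \<open>p\<close>, and descends to it.  Otherwise the
  gradient points form a ray, which is the chosen representative of its own class.\<close>

lemma steepest_descent_exists:
  fixes x0 :: 'a
  assumes f: "distance_limit x0 f"
  shows "\<exists>z. steepest_descent x0 f z"
proof (cases "\<exists>B. \<forall>x. B \<le> f x")
  case True
  then obtain p where "f = (\<lambda>x. dist x p - dist x0 p)"
    using distance_limit_bounded_below[OF f] by blast
  then show ?thesis using steepest_descent_dist by blast
next
  case False
  then have unb: "\<exists>x. f x < B" for B by (meson not_le)
  let ?c = "descent_ray x0 f"
  have c: "ray ?c" by (rule ray_descent_ray[OF f unb])
  define \<xi> where "\<xi> = asymptotic_rel `` {?c}"
  have xi: "\<xi> \<in> weak_boundary"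
    unfolding weak_boundary_def \<xi>_def using c by (intro quotientI) simp
  let ?a = "arc_from x0 (Inr \<xi>)"
  have "(?c, ?a) \<in> asymptotic_rel" using arc_from_boundary(1)[OF xi, of x0] by (simp add: \<xi>_def)
  then have eq: "?c t = ?a t" if "0 \<le> t" for t
    by (rule asymptotic_rays_eq) (use that descent_ray_0[OF f unb] arc_from_boundary(3)[OF xi] in auto)
  have "steepest_descent x0 f (Inr \<xi>)"
    unfolding steepest_descent_def
  proof (intro conjI allI impI)
    show "Inr \<xi> \<in> weak_closure" using xi by (auto simp: weak_closure_def)
    fix t :: real assume t: "0 \<le> t"
    show "f (?a t) = - t"
      using gradient_point_eq(2)[OF f descent_ray_gradient[OF f unb t]] eq[OF t] by simp
  qed simp
  then show ?thesis by blast
qed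

lemma steepest_descent_unique:
  fixes x0 :: 'a
  assumes f: "distance_limit x0 f" and z: "steepest_descent x0 f z" and z': "steepest_descent x0 f z'"
  shows "z = z'"
proof -
  have len: "length_from x0 z = length_from x0 z'"
    using length_from_le_steepest_descent[OF z z'] length_from_le_steepest_descent[OF z' z]
    by (rule antisym[rotated])
  have arc: "arc_from x0 z t = arc_from x0 z' t" if "0 \<le> t" "ereal t \<le> length_from x0 z" for t
    using gradient_point_unique[OF f steepest_descent_gradient[OF z] steepest_descent_gradient[OF z']]
      that len by simp
  show ?thesis
  proof (cases z; cases z')
    fix y y' assume "z = Inl y" "z' = Inl y'"
    with len arc[of "dist x0 y"] show ?thesis
      using arc_from_point(3)[of x0 y] arc_from_point(3)[of x0 y'] by simp
  next
    fix \<xi> \<xi>' assume eqs: "z = Inr \<xi>" "z' = Inr \<xi>'"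
    then have xi: "\<xi> \<in> weak_boundary" "\<xi>' \<in> weak_boundary"
      using steepest_descentD(1)[OF z] steepest_descentD(1)[OF z'] by (auto simp: weak_closure_def)
    have "(arc_from x0 z, arc_from x0 z') \<in> asymptotic_rel"
      unfolding asymptotic_rel_iff
    proof (intro conjI exI[of _ 0] allI impI)
      show "ray (arc_from x0 z)" "ray (arc_from x0 z')" using arc_from_boundary(2) xi eqs by auto
      show "dist (arc_from x0 z t) (arc_from x0 z' t) \<le> 0" if "0 \<le> t" for t
        using arc[OF that] eqs by simp
    qed
    then have "\<xi> = \<xi>'"
      using quotient_eqI[OF equiv_asymptotic_rel, of \<xi> \<xi>'] xi arc_from_boundary(1) eqs
      unfolding weak_boundary_def by blast
    with eqs show ?thesis by simp
  qed (use len in auto)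
qed

text \<open>Sequential continuity of the projection.  Since the length of an arc is the supremum of \<open>- f\<close>,
  it converges: a gradient point of \<open>f\<close> beyond a given level gives a point where \<open>- g n\<close> exceeds that
  level, and conversely.  The points at arc length \<open>b\<close> converge by stability of gradient points, and
  the Busemann inequality propagates this to all smaller parameters uniformly.\<close>

lemma steepest_descent_converges:
  fixes x0 :: 'a
  assumes f: "distance_limit x0 f"
    and unif: "\<And>r e. 0 < e \<Longrightarrow> \<forall>\<^sub>F n in sequentially. \<forall>x\<in>cball x0 r. \<bar>g n x - f x\<bar> < e"
    and z: "steepest_descent x0 f z" and w: "\<And>n. steepest_descent x0 (g n) (w n)"
  shows "weak_converges x0 w z"
proof -
  have lower: "\<forall>\<^sub>F n in sequentially. a < length_from x0 (w n)" if a: "a < length_from x0 z" for a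
  proof (cases "a < 0")
    case True
    then show ?thesis
      by (intro always_eventually allI) (rule less_le_trans[OF _ length_from_nonneg])
  next
    case False
    obtain t where t: "a < ereal t" "ereal t < length_from x0 z" using ereal_dense2[OF a] by auto
    obtain s where s: "a < ereal s" "ereal s < ereal t" using ereal_dense2[OF t(1)] by auto
    have "0 < ereal t" using le_less_trans[of 0 a "ereal t"] False t(1) by (simp only: not_less)
    then have "0 \<le> t" by simp
    let ?p = "arc_from x0 z t"
    have p: "f ?p = - t" "dist x0 ?p = t"
      using steepest_descentD[OF z] dist_arc_from \<open>0 \<le> t\<close> t(2) by auto
    have "\<forall>\<^sub>F n in sequentially. \<forall>x\<in>cball x0 t. \<bar>g n x - f x\<bar> < t - s"
      using s(2) by (intro unif) simp
    then show ?thesis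
    proof eventually_elim
      case (elim n)
      then have "\<bar>g n ?p - f ?p\<bar> < t - s" using p(2) by simp
      then have "s \<le> - g n ?p" using p(1) by linarith
      then have "ereal s \<le> ereal (- g n ?p)" by simp
      then show ?case using s(1) steepest_descentD(2)[OF w[of n], of ?p] by (meson less_le_trans)
    qed
  qed
  have upper: "\<forall>\<^sub>F n in sequentially. length_from x0 (w n) < a" if a: "length_from x0 z < a" for a
  proof -
    obtain r where r: "length_from x0 z = ereal r" "0 \<le> r" using a by (cases z) auto
    obtain s where s: "r < s" "ereal s < a" using ereal_dense2[OF a] r by auto
    have "\<forall>\<^sub>F n in sequentially. \<forall>x\<in>cball x0 s. \<bar>g n x - f x\<bar> < s - r"
      using s(1) by (intro unif) simp
    then show ?thesis
    proof eventually_elim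
      case (elim n)
      show ?case
      proof (rule ccontr)
        assume "\<not> length_from x0 (w n) < a"
        with s(2) have len: "ereal s \<le> length_from x0 (w n)" by (meson not_less less_imp_le order_trans)
        have s0: "0 \<le> s" using s(1) r(2) by simp
        let ?q = "arc_from x0 (w n) s"
        have q: "g n ?q = - s" "dist x0 ?q = s"
          using steepest_descentD[OF w] dist_arc_from len s0 by auto
        have "?q \<in> cball x0 s" using q(2) by simp
        then have "\<bar>g n ?q - f ?q\<bar> < s - r" using elim by blast
        then have "r < - f ?q" using q(1) by linarith
        with steepest_descentD(2)[OF z, of ?q] r(1) show False by simp
      qed
    qed
  qed
  have arcs: "uniform_limit {a..b} (\<lambda>k. arc_from x0 (w k)) (arc_from x0 z) sequentially"
    if ab: "0 \<le> a" "a \<le> b" "ereal b < length_from x0 z" for a b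
    unfolding uniform_limit_iff
  proof (intro allI impI)
    fix e :: real assume "0 < e"
    have b: "0 \<le> b" "ereal b \<le> length_from x0 z" using ab by auto
    obtain d where d: "0 < d" "\<And>q. dist x0 q \<le> b \<Longrightarrow> f q < - b + d \<Longrightarrow> dist q (arc_from x0 z b) < e"
      using gradient_point_stable[OF f steepest_descent_gradient[OF z b] \<open>0 < e\<close>] by blast
    show "\<forall>\<^sub>F n in sequentially. \<forall>t\<in>{a..b}. dist (arc_from x0 (w n) t) (arc_from x0 z t) < e"
      using lower[OF ab(3)] unif[OF d(1), of b]
    proof eventually_elim
      case (elim n)
      let ?q = "arc_from x0 (w n) b"
      have len: "ereal b \<le> length_from x0 (w n)" using elim(1) by simp
      have q: "g n ?q = - b" "dist x0 ?q = b"
        using steepest_descentD[OF w] dist_arc_from len b by auto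
      have "?q \<in> cball x0 b" using q(2) by simp
      then have "\<bar>g n ?q - f ?q\<bar> < d" using elim(2) by blast
      then have "f ?q < - b + d" using q(1) by linarith
      with d(2) q(2) have close: "dist ?q (arc_from x0 z b) < e" by simp
      show ?case
      proof
        fix t assume "t \<in> {a..b}"
        then have "0 \<le> t" "t \<le> b" using ab by auto
        from arc_from_convex[OF steepest_descentD(1)[OF w] steepest_descentD(1)[OF z] this len b(2)]
        show "dist (arc_from x0 (w n) t) (arc_from x0 z t) < e" using close by (rule le_less_trans)
      qed
    qed
  qed
  show ?thesis
    unfolding weak_converges_def using lower upper arcs by (auto intro: order_tendstoI)
qed

end

section \<open>The coarse closure\<close>

lemma mem_const_class: "f \<in> const_class f"
  unfolding const_class_def by (auto intro: exI[of _ 0])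

lemma const_class_eq_iff: "const_class f = const_class g \<longleftrightarrow> (\<exists>a. \<forall>x. f x = g x + a)"
proof
  assume "const_class f = const_class g"
  then have "f \<in> const_class g" using mem_const_class by blast
  then show "\<exists>a. \<forall>x. f x = g x + a" by (auto simp: const_class_def)
next
  assume "\<exists>a. \<forall>x. f x = g x + a"
  then obtain a where a: "f = (\<lambda>x. g x + a)" by auto
  have "(\<lambda>x. f x + b) = (\<lambda>x. g x + (a + b))" "(\<lambda>x. g x + b) = (\<lambda>x. f x + (b - a))" for b
    unfolding a by auto
  then show "const_class f = const_class g" unfolding const_class_def by blast
qed

lemma const_class_normalized: "const_class (\<lambda>x. g x - a) = const_class g"
  unfolding const_class_eq_iff by (auto intro: exI[of _ "- a"])

lemma const_class_inj_normalized:
  assumes "const_class f = const_class g" "f x0 = 0" "g x0 = 0"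
  shows "f = g"
  using assms unfolding const_class_eq_iff by auto

lemma topspace_cont_fun_mod_const:
  "topspace cont_fun_mod_const_topology = const_class ` {f. continuous_on UNIV f}"
  unfolding cont_fun_mod_const_topology_def
  by (rule quotient_imp_surjective_map[OF quotient_map_quotient_topology[of cont_fun_topology const_class],
        unfolded topspace_cont_fun_topology, symmetric])

text \<open>Basic neighbourhoods of the class of \<open>f\<close>, for \<open>f\<close> vanishing at \<open>x0\<close>.  Normalizing \<open>g\<close> inside the
  estimate makes the condition independent of the representative.\<close>

definition class_nhd :: "'a::metric_space \<Rightarrow> ('a \<Rightarrow> real) \<Rightarrow> 'a set \<Rightarrow> real \<Rightarrow> ('a \<Rightarrow> real) set set" where
  "class_nhd x0 f K e =
     const_class ` {g. continuous_on UNIV g \<and> (\<forall>x\<in>K. \<bar>g x - g x0 - f x\<bar> < e)}"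

lemma const_class_in_class_nhd:
  "const_class g \<in> class_nhd x0 f K e \<longleftrightarrow>
     continuous_on UNIV g \<and> (\<forall>x\<in>K. \<bar>g x - g x0 - f x\<bar> < e)"
proof
  assume "const_class g \<in> class_nhd x0 f K e"
  then obtain h where h: "const_class g = const_class h" "continuous_on UNIV h"
    "\<forall>x\<in>K. \<bar>h x - h x0 - f x\<bar> < e" by (auto simp: class_nhd_def)
  from h(1) obtain a where "g = (\<lambda>x. h x + a)" unfolding const_class_eq_iff by auto
  with h(2,3) show "continuous_on UNIV g \<and> (\<forall>x\<in>K. \<bar>g x - g x0 - f x\<bar> < e)"
    by (auto intro: continuous_intros)
qed (auto simp: class_nhd_def)

text \<open>The continuous function \<open>|g x - g x0 - f x|\<close> attains its maximum \<open>m < e\<close> on \<open>K\<close>.  A perturbation of \<open>g\<close>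
  by less than \<open>(e - m)/2\<close> on \<open>K\<close> and at \<open>x0\<close> changes it by less than \<open>e - m\<close>.\<close>

lemma openin_class_nhd:
  assumes f: "continuous_on UNIV f" and K: "compact K"
  shows "openin cont_fun_mod_const_topology (class_nhd x0 f K e)"
proof -
  have "\<exists>L d. compact L \<and> 0 < d \<and> {h. continuous_on UNIV h \<and> (\<forall>x\<in>L. \<bar>h x - g x\<bar> < d)}
      \<subseteq> {h. continuous_on UNIV h \<and> (\<forall>x\<in>K. \<bar>h x - h x0 - f x\<bar> < e)}"
    if g: "continuous_on UNIV g" "\<forall>x\<in>K. \<bar>g x - g x0 - f x\<bar> < e" for g
  proof -
    have "\<exists>m<e. \<forall>x\<in>K. \<bar>g x - g x0 - f x\<bar> \<le> m"
    proof (cases "K = {}")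
      case True
      then show ?thesis by (auto intro: exI[of _ "e - 1"])
    next
      case False
      have "continuous_on K (\<lambda>x. \<bar>g x - g x0 - f x\<bar>)"
        using continuous_on_subset[OF f] continuous_on_subset[OF g(1)]
        by (intro continuous_intros) auto
      from continuous_attains_sup[OF K False this] g(2) show ?thesis by blast
    qed
    then obtain m where m: "m < e" "\<forall>x\<in>K. \<bar>g x - g x0 - f x\<bar> \<le> m" by blast
    show ?thesis
    proof (intro exI conjI subsetI)
      show "compact (insert x0 K)" using K by simp
      show "0 < (e - m) / 2" using m(1) by simp
      fix h assume "h \<in> {h. continuous_on UNIV h \<and> (\<forall>x\<in>insert x0 K. \<bar>h x - g x\<bar> < (e - m) / 2)}"
      then have h: "continuous_on UNIV h" "\<bar>h x0 - g x0\<bar> < (e - m) / 2"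
        "\<And>x. x \<in> K \<Longrightarrow> \<bar>h x - g x\<bar> < (e - m) / 2" by auto
      have "\<bar>h x - h x0 - f x\<bar> < e" if "x \<in> K" for x
      proof -
        have gm: "\<bar>g x - g x0 - f x\<bar> \<le> m" using m(2) that by blast
        have "h x - h x0 - f x = (g x - g x0 - f x) + (h x - g x) - (h x0 - g x0)" by simp
        then have "\<bar>h x - h x0 - f x\<bar> \<le> \<bar>g x - g x0 - f x\<bar> + \<bar>h x - g x\<bar> + \<bar>h x0 - g x0\<bar>"
          using abs_triangle_ineq4[of "(g x - g x0 - f x) + (h x - g x)" "h x0 - g x0"]
            abs_triangle_ineq[of "g x - g x0 - f x" "h x - g x"] by linarith
        also have "\<dots> < m + (e - m) / 2 + (e - m) / 2" using gm h(2) h(3)[OF that] by linarith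
        finally show ?thesis by (simp add: field_simps)
      qed
      with h(1) show "h \<in> {h. continuous_on UNIV h \<and> (\<forall>x\<in>K. \<bar>h x - h x0 - f x\<bar> < e)}" by blast
    qed
  qed
  then have "openin cont_fun_topology {h. continuous_on UNIV h \<and> (\<forall>x\<in>K. \<bar>h x - h x0 - f x\<bar> < e)}"
    unfolding openin_cont_fun_topology by (intro conjI ballI) (auto simp del: Collect_mono_iff)
  then show ?thesis
    unfolding cont_fun_mod_const_topology_def openin_quotient_topology topspace_cont_fun_topology
    using const_class_in_class_nhd[of _ x0 f K e] by (auto simp: class_nhd_def)
qed

lemma coarse_closure_iff:
  "F \<in> coarse_closure x0 \<longleftrightarrow> (\<exists>f. distance_limit x0 f \<and> F = const_class f)"
proof
  assume "F \<in> coarse_closure x0"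
  then have F: "F \<in> topspace cont_fun_mod_const_topology"
    and meet: "\<And>U. F \<in> U \<Longrightarrow> openin cont_fun_mod_const_topology U \<Longrightarrow> \<exists>y. coarse_embedding x0 y \<in> U"
    unfolding coarse_closure_def in_closure_of by blast+
  obtain g where g: "F = const_class g" "continuous_on UNIV g"
    using F by (auto simp: topspace_cont_fun_mod_const)
  define f where "f x = g x - g x0" for x
  have f: "continuous_on UNIV f" unfolding f_def by (intro continuous_intros g(2))
  have "distance_limit x0 f"
    unfolding distance_limit_def
  proof (intro conjI allI impI)
    show "f x0 = 0" by (simp add: f_def)
    fix K :: "'a set" and e :: real assume K: "compact K" and e: "0 < e"
    have "F \<in> class_nhd x0 f K e"
      unfolding g(1) const_class_in_class_nhd using g(2) e by (simp add: f_def)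
    from meet[OF this openin_class_nhd[OF f K]]
    show "\<exists>y. \<forall>x\<in>K. \<bar>dist x y - dist x0 y - f x\<bar> < e"
      by (auto simp: coarse_embedding_def const_class_in_class_nhd)
  qed
  moreover have "F = const_class f" unfolding g(1) f_def by (rule const_class_normalized[symmetric])
  ultimately show "\<exists>f. distance_limit x0 f \<and> F = const_class f" by blast
next
  assume "\<exists>f. distance_limit x0 f \<and> F = const_class f"
  then obtain f where f: "distance_limit x0 f" "F = const_class f" by blast
  have cont: "continuous_on UNIV f" by (rule distance_limit_continuous[OF f(1)])
  have "\<exists>y. coarse_embedding x0 y \<in> U"
    if U: "F \<in> U" "openin cont_fun_mod_const_topology U" for U
  proof -
    have "openin cont_fun_topology {g. continuous_on UNIV g \<and> const_class g \<in> U}"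
      using U(2) by (simp add: cont_fun_mod_const_topology_def openin_quotient_topology
          topspace_cont_fun_topology)
    moreover have "f \<in> {g. continuous_on UNIV g \<and> const_class g \<in> U}" using cont U(1) f(2) by simp
    ultimately obtain K e where K: "compact K" "0 < e"
      "{g. continuous_on UNIV g \<and> (\<forall>x\<in>K. \<bar>g x - f x\<bar> < e)} \<subseteq> {g. continuous_on UNIV g \<and> const_class g \<in> U}"
      unfolding openin_cont_fun_topology by blast
    obtain y where "\<forall>x\<in>K. \<bar>dist x y - dist x0 y - f x\<bar> < e"
      using f(1) K(1,2) unfolding distance_limit_def by blast
    moreover have "continuous_on UNIV (\<lambda>x. dist x y - dist x0 y)" by (intro continuous_intros)
    ultimately show ?thesis using K(3) unfolding coarse_embedding_def by blast
  qed
  then show "F \<in> coarse_closure x0"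
    unfolding coarse_closure_def in_closure_of topspace_cont_fun_mod_const
    using f(2) cont by blast
qed

lemma topspace_coarse_topology: "topspace (coarse_topology x0) = coarse_closure x0"
  unfolding coarse_topology_def topspace_subtopology
  using closure_of_subset_topspace[of cont_fun_mod_const_topology] by (auto simp: coarse_closure_def)

lemma coarse_embedding_in_closure: "coarse_embedding x0 y \<in> coarse_closure x0"
  unfolding coarse_closure_iff coarse_embedding_def using distance_limit_dist by blast

section \<open>The projection\<close>

text \<open>The description is uniquely satisfied on the coarse closure: \<open>f\<close> is the only normalized
  representative of \<open>F\<close>, and it descends to exactly one \<open>z\<close>.\<close>

definition coarse_projection :: "'a::metric_space \<Rightarrow> ('a \<Rightarrow> real) set \<Rightarrow> 'a + (real \<Rightarrow> 'a) set" where
  "coarse_projection x0 F =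
     (THE z. \<exists>f. distance_limit x0 f \<and> F = const_class f \<and> steepest_descent x0 f z)"

context proper_busemann
begin

lemma coarse_projection_eq:
  fixes x0 :: 'a
  assumes f: "distance_limit x0 f" and z: "steepest_descent x0 f z"
  shows "coarse_projection x0 (const_class f) = z"
  unfolding coarse_projection_def
proof (rule the_equality)
  show "\<exists>g. distance_limit x0 g \<and> const_class f = const_class g \<and> steepest_descent x0 g z"
    using f z by blast
  fix w assume "\<exists>g. distance_limit x0 g \<and> const_class f = const_class g \<and> steepest_descent x0 g w"
  then obtain g where g: "distance_limit x0 g" "const_class f = const_class g" "steepest_descent x0 g w"
    by blast
  then have "f = g" using const_class_inj_normalized[of f g x0] f by (simp add: distance_limit_def)
  with g(3) show "w = z" using steepest_descent_unique[OF f] z by blast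
qed

lemma steepest_descent_coarse_projection:
  fixes x0 :: 'a
  assumes f: "distance_limit x0 f"
  shows "steepest_descent x0 f (coarse_projection x0 (const_class f))"
  using steepest_descent_exists[OF f] coarse_projection_eq[OF f] by blast

lemma coarse_projection_embedding: "coarse_projection x0 (coarse_embedding x0 y) = Inl (y :: 'a)"
  unfolding coarse_embedding_def
  by (rule coarse_projection_eq[OF distance_limit_dist steepest_descent_dist])

text \<open>An interior point is the image of its own distance class.  A boundary point is represented by
  a ray from \<open>x0\<close>, along which the Busemann function of that ray descends at unit speed.\<close>

lemma coarse_projection_surjective:
  "coarse_projection x0 ` coarse_closure x0 = (weak_closure :: ('a + (real \<Rightarrow> 'a) set) set)"
proof
  show "coarse_projection x0 ` coarse_closure x0 \<subseteq> weak_closure"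
    using steepest_descentD(1)[OF steepest_descent_coarse_projection]
    by (auto simp: coarse_closure_iff)
  show "weak_closure \<subseteq> coarse_projection x0 ` coarse_closure x0"
  proof
    fix z :: "'a + (real \<Rightarrow> 'a) set" assume z: "z \<in> weak_closure"
    show "z \<in> coarse_projection x0 ` coarse_closure x0"
    proof (cases z)
      case (Inl y)
      with coarse_projection_embedding[of x0 y] coarse_embedding_in_closure[of x0 y]
      show ?thesis by (metis image_eqI)
    next
      case (Inr \<xi>)
      with z have xi: "\<xi> \<in> weak_boundary" by (auto simp: weak_closure_def)
      let ?c = "arc_from x0 (Inr \<xi>)"
      obtain f where f: "distance_limit x0 f" "\<And>t. 0 \<le> t \<Longrightarrow> f (?c t) = f (?c 0) - t"
        by (rule ray_busemann_function[OF arc_from_boundary(2)[OF xi], of x0 x0]) (rule that)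
      have "f x0 = 0" using f(1) by (simp add: distance_limit_def)
      then have "f (?c t) = - t" if "0 \<le> t" for t
        using f(2)[OF that] arc_from_boundary(3)[OF xi, of x0] by simp
      with z Inr have "steepest_descent x0 f z" by (simp add: steepest_descent_def)
      from coarse_projection_eq[OF f(1) this] f(1) show ?thesis
        by (metis coarse_closure_iff image_eqI)
    qed
  qed
qed

text \<open>Closed balls are compact and exhaust the space, so each class has a countable base of
  neighbourhoods, given by the balls of radius \<open>n\<close> and the tolerance \<open>1/(n+1)\<close>.  Hence sequential
  continuity suffices, which is also all that can be used of the target: its topology is
  given through convergent sequences.\<close>

lemma continuous_coarse_projection:
  fixes x0 :: 'a
  shows "continuous_map (coarse_topology x0) (weak_topology x0) (coarse_projection x0)"
  unfolding continuous_map_def topspace_coarse_topology topspace_weak_topology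
proof (intro conjI allI impI)
  show "coarse_projection x0 \<in> coarse_closure x0 \<rightarrow> weak_closure"
    using coarse_projection_surjective[of x0] by blast
  fix U assume U: "openin (weak_topology x0) U"
  let ?V = "{F \<in> coarse_closure x0. coarse_projection x0 F \<in> U}"
  show "openin (coarse_topology x0) ?V"
  proof (subst openin_subopen, intro ballI)
    fix F assume F: "F \<in> ?V"
    then obtain f where f: "distance_limit x0 f" "F = const_class f"
      by (auto simp: coarse_closure_iff)
    let ?N = "\<lambda>n. class_nhd x0 f (cball x0 (real n)) (1 / real (Suc n))"
    \<comment> \<open>otherwise a sequence of classes outside \<open>?V\<close> would converge to \<open>F\<close>\<close>
    have "\<exists>n. coarse_closure x0 \<inter> ?N n \<subseteq> ?V"
    proof (rule ccontr)
      assume "\<nexists>n. coarse_closure x0 \<inter> ?N n \<subseteq> ?V"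
      then have "\<exists>G. G \<in> coarse_closure x0 \<and> G \<in> ?N n \<and> coarse_projection x0 G \<notin> U" for n
        by blast
      then have "\<exists>g. distance_limit x0 g \<and> const_class g \<in> ?N n \<and>
          coarse_projection x0 (const_class g) \<notin> U" for n
        unfolding coarse_closure_iff by blast
      then obtain g where g: "\<And>n. distance_limit x0 (g n)" "\<And>n. const_class (g n) \<in> ?N n"
        "\<And>n. coarse_projection x0 (const_class (g n)) \<notin> U" by metis
      have close: "\<bar>g n x - f x\<bar> < 1 / real (Suc n)" if "dist x0 x \<le> real n" for n x
        using g(1)[of n] g(2)[of n] that
        by (simp add: const_class_in_class_nhd distance_limit_def)
      have "weak_converges x0 (\<lambda>n. coarse_projection x0 (const_class (g n))) (coarse_projection x0 F)"
        unfolding f(2)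
      proof (rule steepest_descent_converges[OF f(1)])
        fix r e :: real assume "0 < e"
        obtain N where N: "r \<le> real N" using real_arch_simple by blast
        have "\<forall>\<^sub>F n in sequentially. 1 / real (Suc n) < e"
          using order_tendstoD(2)[OF LIMSEQ_Suc[OF lim_1_over_n] \<open>0 < e\<close>] by simp
        then show "\<forall>\<^sub>F n in sequentially. \<forall>x\<in>cball x0 r. \<bar>g n x - f x\<bar> < e"
          using eventually_ge_at_top[of N]
        proof eventually_elim
          case (elim n)
          show ?case
          proof
            fix x assume "x \<in> cball x0 r"
            then have "dist x0 x \<le> real n" using N elim(2) by simp
            from close[OF this] elim(1) show "\<bar>g n x - f x\<bar> < e" by linarith
          qed
        qed
      qed (intro steepest_descent_coarse_projection f(1) g(1))+
      moreover have "coarse_projection x0 (const_class (g n)) \<in> weak_closure" for n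
        using steepest_descentD(1)[OF steepest_descent_coarse_projection[OF g(1)]] .
      ultimately have conv: "(\<forall>n. coarse_projection x0 (const_class (g n)) \<in> weak_closure) \<and>
          weak_converges x0 (\<lambda>n. coarse_projection x0 (const_class (g n))) (coarse_projection x0 F)"
        by blast
      have FU: "coarse_projection x0 F \<in> U" using F by simp
      have "\<forall>\<^sub>F n in sequentially. coarse_projection x0 (const_class (g n)) \<in> U"
        by (rule mp[OF spec[OF bspec[OF conjunct2[OF U[unfolded openin_weak_topology]] FU]] conv])
      from eventually_happens'[OF sequentially_bot this] g(3) show False by blast
    qed
    then obtain n where n: "coarse_closure x0 \<inter> ?N n \<subseteq> ?V" by blast
    have cont: "continuous_on UNIV f" by (rule distance_limit_continuous[OF f(1)])
    have "openin (coarse_topology x0) (coarse_closure x0 \<inter> ?N n)"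
      unfolding coarse_topology_def
      by (rule openin_subtopology_Int2[OF openin_class_nhd[OF cont compact_cball]])
    moreover have "F \<in> coarse_closure x0 \<inter> ?N n"
      using F f cont by (simp add: const_class_in_class_nhd distance_limit_def)
    ultimately show "\<exists>T. openin (coarse_topology x0) T \<and> F \<in> T \<and> T \<subseteq> ?V" using n by blast
  qed
qed

end

theorem theorem0p1:
  fixes x0 :: "'a::metric_space"
  assumes "busemann_space TYPE('a)"
    and "locally compact (UNIV :: 'a set)"
    and "\<forall>x y :: 'a. \<exists>S. geodesic_segment_between x y S"
    and "complete (UNIV :: 'a set)"
  shows "\<exists>Pr :: ('a \<Rightarrow> real) set \<Rightarrow> 'a + (real \<Rightarrow> 'a) set.
           continuous_map (coarse_topology x0) (weak_topology x0) Pr \<and>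
           Pr ` coarse_closure x0 = weak_closure \<and>
           (\<forall>y. Pr (coarse_embedding x0 y) = Inl y)"


proof -
  interpret proper_busemann "TYPE('a)"
    using assms by unfold_locales
  show ?thesis
    using continuous_coarse_projection coarse_projection_surjective coarse_projection_embedding
    by blast
qed

end
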